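(* Let $f:\mathbb{R}^n\to\mathbb{R}$ be a (possibly non-strongly-convex) function with $L_1$-Lipschitz gradient ($L_1>0$), let $c\in[0,1)$, let $$h\in\Bigl(0,\frac{\sqrt{2(1+c^2)}-2c}{2L_1}\Bigr),$$ and suppose that gradient descent (GD) applied to the regularised problem $\min_x f(x)+\lambda\|x\|^2$ with $\lambda=\frac{1-c}{2h}$, i.e. $z_{k+1}=cz_k-h\nabla f(z_k)$, converges to a fixed point $z^e$. Let $\sigma\ge0$ and, for $\mu>0$, $t\in\mathbb{N}$, $t\ge1$, put $$Q(\mu,t)=h\,\frac{\mu}{2}L_1(n+3)^{3/2}+hL_1\sqrt{\frac{2h^2\sigma^2}{t(1-c^2-4cL_1h-2L_1^2h^2)}}.$$ Then there exist constants $\bar\mu,\bar q,\bar r>0$ and $\bar t\in\mathbb{N}$ (depending on $h$, $c$, $L_1$ and a Lyapunov function of the GD dynamics at $z^e$), a class-$\mathcal{KL}$ function $\kappa$ and a class-$\mathcal{K}$ function $\alpha$ such that every GD trajectory with $z_0\in\mathcal{B}_{\bar r}(z^e)$ satisfies $\|z_k-z^e\|\le\kappa(\|z_0-z^e\|,k)$ for all $k\ge0$ and, for any $\mu\in(0,\bar\mu)$ and $t\ge\bar t$ with $Q(\mu,t)\le\bar q$ for which the zeroth-order oracle satisfies the variance bound with constant $\sigma^2$, the averaged iterates $\bar z_k$ of zeroth-order gradient descent (ZO-GD) for the regularised problem started at $\bar z_0\in\mathcal{B}_{\bar r}(z^e)$ have the same decay rate as GD and converge to $\mathcal{B}_r(z^e)$,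 i.e. $$\|\bar z_k-z^e\|\le\kappa(\|\bar z_0-z^e\|,k)+r,\qquad r=\alpha\!\left(h\,\frac{\mu}{2}L_1(n+3)^{3/2}+hL_1\sqrt{\frac{2h^2\sigma^2}{t(1-c^2-4cL_1h-2L_1^2h^2)}}\right),\qquad k\ge0.$$
   Context: $\|\cdot\|$ is the Euclidean norm; $\mathcal{B}_\delta(z^* )=\{z:\|z-z^*\|\le\delta\}$. A continuous $\alpha:[0,a)\to[0,\infty)$ ($a>0$ or $a=\infty$) is of class $\mathcal{K}$ if it is strictly increasing and $\alpha(0)=0$; of class $\mathcal{K}_\infty$ if in addition $a=\infty$ and $\alpha(s)\to\infty$ as $s\to\infty$. A continuous $\kappa:[0,\infty)\times[0,\infty)\to[0,\infty)$ is of class $\mathcal{KL}$ if $\kappa(\cdot,t)\in\mathcal{K}$ for each fixed $t\ge0$ and, for each fixed $s\ge0$, $\kappa(s,\cdot)$ is decreasing (not necessarily strictly) with $\kappa(s,t)\to0$ as $t\to\infty$. $f$ is continuously differentiable and bounded below. Lipschitz gradient: $\|\nabla f(x)-\nabla f(y)\|\le L_1\|x-y\|$. A Lyapunov function of a map $w$ at a fixed point $z^e$: a locally Lipschitz $V\ge0$ such that, for some $\alpha_1,\alpha_2,\alpha_3\in\mathcal{K}_\infty$ and $R>0$, $\alpha_1(\|z-z^e\|)\le V(z)\le\alpha_2(\|z-z^e\|)$ and $V(w(z))-V(z)\le-\alpha_3(\|z-z^e\|)$ for all $z\in\mathcal{B}_R(z^e)$. Here $w(z)=cz-h\nabla f(z)$.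 Gaussian smoothing: $f_\mu(x)=E_u[f(x+\mu u)]$ with $u\sim\mathcal{N}(0,I_n)$. Two-point oracle: $\frac1\mu(f(x+\mu u)-f(x))u$, whose expectation is $\nabla f_\mu(x)$. Variance bound: $E_u[\|\frac1\mu(f(x+\mu u)-f(x))u-\nabla f_\mu(x)\|^2]\le\sigma^2$ for all $x$. In the algorithm, $g_\mu(x)$ denotes the average of $t$ independent evaluations of the two-point oracle at $x$, with directions independent of all earlier iterations. ZO-GD for the regularised problem: $\tilde z_{k+1}=c\tilde z_k-h\,g_\mu(\tilde z_k)$ with deterministic $\tilde z_0$; its averaged iterates are $\bar z_k=E[\tilde z_k]$, so $\bar z_0=\tilde z_0$. *)

theory Defs
  imports "HOL-Probability.Probability"
begin

section \<open>Comparison functions\<close>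

text \<open>The domain of a class-K function is the half-open interval from 0 to a, with a possibly
  infinite; only values there matter. Nonnegativity on the domain follows from monotonicity
  and the value at 0.\<close>

definition K_dom :: "ereal \<Rightarrow> real set" where
  "K_dom a = {s. 0 \<le> s \<and> ereal s < a}"

definition class_K :: "ereal \<Rightarrow> (real \<Rightarrow> real) \<Rightarrow> bool" where
  "class_K a \<alpha> \<longleftrightarrow>
     0 < a \<and> continuous_on (K_dom a) \<alpha> \<and> strict_mono_on (K_dom a) \<alpha> \<and> \<alpha> 0 = 0"

definition class_K_infinity :: "(real \<Rightarrow> real) \<Rightarrow> bool" where
  "class_K_infinity \<alpha> \<longleftrightarrow> class_K \<infinity> \<alpha> \<and> filterlim \<alpha> at_top at_top"

definition class_KL :: "(real \<Rightarrow> real \<Rightarrow> real) \<Rightarrow> bool" where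
  "class_KL \<kappa> \<longleftrightarrow>
     continuous_on ({0..} \<times> {0..}) (\<lambda>(s, t). \<kappa> s t) \<and>
     (\<forall>t\<ge>0. class_K \<infinity> (\<lambda>s. \<kappa> s t)) \<and>
     (\<forall>s\<ge>0. antimono_on {0..} (\<kappa> s) \<and> (\<kappa> s \<longlongrightarrow> 0) at_top)"

section \<open>Gradient descent and Lyapunov functions\<close>

text \<open>Meaningful only where the function is differentiable.\<close>

definition grad :: "('a::euclidean_space \<Rightarrow> real) \<Rightarrow> 'a \<Rightarrow> 'a" where
  "grad f x = (THE D. GDERIV f x :> D)"

text \<open>One gradient step of size h on the objective f(x) + (1 - c)/(2h) |x|^2;
  see \<open>gd_map_regularised\<close> below.\<close>

definition gd_map :: "real \<Rightarrow> real \<Rightarrow> ('a::euclidean_space \<Rightarrow> real) \<Rightarrow> 'a \<Rightarrow> 'a" where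
  "gd_map c h f z = c *\<^sub>R z - h *\<^sub>R grad f z"

definition gd_trajectory ::
    "real \<Rightarrow> real \<Rightarrow> ('a::euclidean_space \<Rightarrow> real) \<Rightarrow> (nat \<Rightarrow> 'a) \<Rightarrow> bool" where
  "gd_trajectory c h f z \<longleftrightarrow> (\<forall>k. z (Suc k) = gd_map c h f (z k))"

text \<open>The limit is required for trajectories started in some neighbourhood of the fixed point,
  which is weaker than convergence from every starting point.\<close>

definition gd_converges_to ::
    "real \<Rightarrow> real \<Rightarrow> ('a::euclidean_space \<Rightarrow> real) \<Rightarrow> 'a \<Rightarrow> bool" where
  "gd_converges_to c h f ze \<longleftrightarrow>
     gd_map c h f ze = ze \<and>
     (\<exists>\<delta>>0. \<forall>z. gd_trajectory c h f z \<and> z 0 \<in> cball ze \<delta> \<longrightarrow> z \<longlonglongrightarrow> ze)"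

text \<open>The library notion of local Lipschitz continuity is for time-dependent functions;
  here it is used with a function that ignores time.\<close>

definition lyapunov_function ::
    "('a::euclidean_space \<Rightarrow> 'a) \<Rightarrow> 'a \<Rightarrow> ('a \<Rightarrow> real) \<Rightarrow> bool" where
  "lyapunov_function w ze V \<longleftrightarrow>
     local_lipschitz (UNIV :: real set) UNIV (\<lambda>_. V) \<and> (\<forall>z. 0 \<le> V z) \<and>
     (\<exists>\<alpha>1 \<alpha>2 \<alpha>3 R.
        class_K_infinity \<alpha>1 \<and> class_K_infinity \<alpha>2 \<and> class_K_infinity \<alpha>3 \<and> R > 0 \<and>
        (\<forall>z\<in>cball ze R.
           \<alpha>1 (norm (z - ze)) \<le> V z \<and> V z \<le> \<alpha>2 (norm (z - ze)) \<and>
           V (w z) - V z \<le> - \<alpha>3 (norm (z - ze))))"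

section \<open>Zeroth-order gradient descent\<close>

text \<open>The law N(0, I): the coordinates are independent standard normal variables.\<close>

definition std_gaussian :: "'a::euclidean_space measure" where
  "std_gaussian = density lborel (\<lambda>u. ennreal (\<Prod>b\<in>Basis. std_normal_density (u \<bullet> b)))"

definition gaussian_smoothing ::
    "real \<Rightarrow> ('a::euclidean_space \<Rightarrow> real) \<Rightarrow> 'a \<Rightarrow> real" where
  "gaussian_smoothing \<mu> f x = (LINT u|std_gaussian. f (x + \<mu> *\<^sub>R u))"

definition zo_oracle ::
    "('a::euclidean_space \<Rightarrow> real) \<Rightarrow> real \<Rightarrow> 'a \<Rightarrow> 'a \<Rightarrow> 'a" where
  "zo_oracle f \<mu> x u = ((f (x + \<mu> *\<^sub>R u) - f x) / \<mu>) *\<^sub>R u"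

text \<open>The expectation is a nonnegative extended integral, so that the bound also
  asserts integrability.\<close>

definition zo_variance_bound ::
    "('a::euclidean_space \<Rightarrow> real) \<Rightarrow> real \<Rightarrow> real \<Rightarrow> bool" where
  "zo_variance_bound f \<mu> \<sigma> \<longleftrightarrow>
     (\<forall>x. (\<integral>\<^sup>+ u. ennreal ((norm (zo_oracle f \<mu> x u - grad (gaussian_smoothing \<mu> f) x))\<^sup>2)
             \<partial>std_gaussian) \<le> ennreal (\<sigma>\<^sup>2))"

definition zo_gradient ::
    "('a::euclidean_space \<Rightarrow> real) \<Rightarrow> real \<Rightarrow> nat \<Rightarrow> 'a \<Rightarrow> (nat \<Rightarrow> 'a) \<Rightarrow> 'a" where
  "zo_gradient f \<mu> t x u = (1 / real t) *\<^sub>R (\<Sum>i<t. zo_oracle f \<mu> x (u i))"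

text \<open>\<open>U k i\<close> is the direction of the i-th oracle call in iteration k. Mutual independence
  of the whole family makes the calls of one iteration independent of each other and of
  all earlier iterations.\<close>

definition zo_directions ::
    "'w measure \<Rightarrow> nat \<Rightarrow> (nat \<Rightarrow> nat \<Rightarrow> 'w \<Rightarrow> 'a::euclidean_space) \<Rightarrow> bool" where
  "zo_directions M t U \<longleftrightarrow>
     prob_space M \<and>
     prob_space.indep_vars M (\<lambda>_. borel) (\<lambda>(k, i). U k i) (UNIV \<times> {..<t}) \<and>
     (\<forall>k. \<forall>i<t. distr M borel (U k i) = std_gaussian)"

fun zo_iterate ::
    "real \<Rightarrow> real \<Rightarrow> ('a::euclidean_space \<Rightarrow> real) \<Rightarrow> real \<Rightarrow> nat \<Rightarrow>
     (nat \<Rightarrow> nat \<Rightarrow> 'w \<Rightarrow> 'a) \<Rightarrow> 'a \<Rightarrow> nat \<Rightarrow> 'w \<Rightarrow> 'a" where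
  "zo_iterate c h f \<mu> t U z0 0 \<omega> = z0"
| "zo_iterate c h f \<mu> t U z0 (Suc k) \<omega> =
     c *\<^sub>R zo_iterate c h f \<mu> t U z0 k \<omega>
     - h *\<^sub>R zo_gradient f \<mu> t (zo_iterate c h f \<mu> t U z0 k \<omega>) (\<lambda>i. U k i \<omega>)"

definition zo_mean ::
    "'w measure \<Rightarrow> real \<Rightarrow> real \<Rightarrow> ('a::euclidean_space \<Rightarrow> real) \<Rightarrow> real \<Rightarrow> nat \<Rightarrow>
     (nat \<Rightarrow> nat \<Rightarrow> 'w \<Rightarrow> 'a) \<Rightarrow> 'a \<Rightarrow> nat \<Rightarrow> 'a" where
  "zo_mean M c h f \<mu> t U z0 k = (LINT \<omega>|M. zo_iterate c h f \<mu> t U z0 k \<omega>)"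

text \<open>The argument n is the dimension of the space.\<close>

definition Q_bound ::
    "nat \<Rightarrow> real \<Rightarrow> real \<Rightarrow> real \<Rightarrow> real \<Rightarrow> real \<Rightarrow> nat \<Rightarrow> real" where
  "Q_bound n L1 c h \<sigma> \<mu> t =
     h * (\<mu> / 2) * L1 * (real n + 3) powr (3 / 2)
     + h * L1 * sqrt (2 * h\<^sup>2 * \<sigma>\<^sup>2 / (real t * (1 - c\<^sup>2 - 4 * c * L1 * h - 2 * L1\<^sup>2 * h\<^sup>2)))"

section \<open>The map as a gradient step on the regularised objective\<close>

lemma GDERIV_unique:
  assumes "GDERIV f x :> D" "GDERIV f x :> D'"
  shows "D = D'"
proof -
  have "(\<lambda>y. y \<bullet> D) = (\<lambda>y. y \<bullet> D')"
    using assms has_derivative_unique unfolding gderiv_def by blast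
  then show ?thesis
    by (metis vector_eq_ldot)
qed

lemma grad_eqI: "GDERIV f x :> D \<Longrightarrow> grad f x = D"
  unfolding grad_def by (rule the_equality) (auto intro: GDERIV_unique)

lemma GDERIV_grad:
  fixes f :: "'a::euclidean_space \<Rightarrow> real"
  assumes "f differentiable (at x)"
  shows "GDERIV f x :> grad f x"
proof -
  obtain f' where f': "(f has_derivative f') (at x)"
    using assms unfolding differentiable_def by blast
  define D where "D = (\<Sum>b\<in>Basis. f' b *\<^sub>R b)"
  interpret bounded_linear f'
    using f' by (rule has_derivative_bounded_linear)
  have "f' y = y \<bullet> D" for y
  proof -
    have "f' y = f' (\<Sum>b\<in>Basis. (y \<bullet> b) *\<^sub>R b)"
      by (simp add: euclidean_representation)
    also have "\<dots> = (\<Sum>b\<in>Basis. (y \<bullet> b) * f' b)"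
      by (simp add: sum scaleR)
    also have "\<dots> = y \<bullet> D"
      by (simp add: D_def inner_sum_right mult.commute)
    finally show ?thesis .
  qed
  then have "f' = (\<lambda>y. y \<bullet> D)"
    by (rule ext)
  then have "GDERIV f x :> D"
    using f' unfolding gderiv_def by simp
  then show ?thesis
    using grad_eqI by metis
qed

lemma gd_map_regularised:
  fixes f :: "'a::euclidean_space \<Rightarrow> real"
  assumes "f differentiable (at z)" "h \<noteq> 0"
  shows "gd_map c h f z = z - h *\<^sub>R grad (\<lambda>x. f x + (1 - c) / (2 * h) * (norm x)\<^sup>2) z"
proof -
  define l where "l = (1 - c) / (2 * h)"
  have "((\<lambda>x. f x + l * (x \<bullet> x)) has_derivative
          (\<lambda>y. y \<bullet> grad f z + l * (z \<bullet> y + y \<bullet> z))) (at z)"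
    using GDERIV_grad[OF assms(1)] unfolding gderiv_def
    by (auto intro!: derivative_eq_intros)
  moreover have "(\<lambda>y. y \<bullet> grad f z + l * (z \<bullet> y + y \<bullet> z))
      = (\<lambda>y. y \<bullet> (grad f z + (2 * l) *\<^sub>R z))"
    by (simp add: inner_add_right inner_commute mult_ac)
  ultimately have "GDERIV (\<lambda>x. f x + l * (norm x)\<^sup>2) z :> grad f z + (2 * l) *\<^sub>R z"
    unfolding gderiv_def power2_norm_eq_inner by simp
  then have "grad (\<lambda>x. f x + l * (norm x)\<^sup>2) z = grad f z + (2 * l) *\<^sub>R z"
    by (rule grad_eqI)
  moreover have "h * (2 * l) = 1 - c"
    using assms(2) by (simp add: l_def)
  ultimately show ?thesis
    unfolding l_def[symmetric]
    by (simp add: gd_map_def scaleR_right_distrib scaleR_diff_left)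
qed

end

theory Submission
  imports Defs
begin

text \<open>
  The step size bound is more than a stability condition: it says that
  \<open>1 - c\<^sup>2 - 4 c L1 h - 2 L1\<^sup>2 h\<^sup>2\<close> is positive, equivalently
  \<open>2 (c + h L1)\<^sup>2 < 1 + c\<^sup>2\<close>. Hence \<open>\<rho> = c + h L1\<close> is less than 1 and the gradient
  map is a \<open>\<rho>\<close>-contraction of the whole space. Distance to the fixed point is therefore a
  Lyapunov function, gradient descent decays like \<open>\<rho> ^ k\<close>, and a sequence that follows the
  map up to an error \<open>q\<close> in each step decays in the same way up to an additive
  \<open>q / (1 - \<rho>)\<close> (\<open>perturbed_contraction\<close>). So \<open>\<kappa> s t = s \<rho> powr t\<close> and
  \<open>\<alpha> s = s / (1 - \<rho>)\<close> work, with bounds valid at every distance from the fixed point. What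
  remains is that the averaged iterates follow the gradient map up to the error \<open>Q_bound\<close>
  (\<open>mean_step\<close>).

  Two facts about Gaussian smoothing enter. The oracle is unbiased for the gradient of the
  smoothed function; this is Stein's identity, obtained here by comparing two expansions of the
  mean of a translated function, one of which comes from the Cameron--Martin formula
  (\<open>stein\<close>, \<open>expectation_zo_oracle\<close>). And the smoothed gradient is the average of the
  gradient at the points \<open>x + \<mu> u\<close> (\<open>GDERIV_gaussian_smoothing\<close>), so it has the same
  Lipschitz constant and differs from the gradient at \<open>x\<close> by at most \<open>L1 \<mu>\<close> times the mean
  of \<open>norm u\<close>; multiplied by \<open>h\<close>, this is at most the first term of \<open>Q_bound\<close>
  (\<open>smoothing_bias\<close>).

  The second term is the effect of the fluctuations. By unbiasedness, the next mean is the
  mean of the smoothed gradient step at the random iterate, not the step at the mean; the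
  discrepancy is at most \<open>h L1\<close> times the mean distance of the iterate from its mean. The mean
  square of that distance is multiplied by at most \<open>\<rho>\<^sup>2\<close> in each step, while the independent
  oracle errors, being orthogonal to the past and to each other, add at most
  \<open>h\<^sup>2 \<sigma>\<^sup>2 / t\<close> (\<open>add_centred_noise\<close>, \<open>partial_step_moments\<close>). It therefore stays
  bounded uniformly in time (\<open>fluctuation_bound\<close>).
\<close>

section \<open>The standard Gaussian measure\<close>

lemma norm_squared_eq_sum_coordinates: "(norm u)\<^sup>2 = (\<Sum>b\<in>Basis. (u \<bullet> b)\<^sup>2)"
  for u :: "'a::euclidean_space"
  unfolding power2_norm_eq_inner by (subst euclidean_inner) (simp add: power2_eq_square)

lemma std_gaussian_density_eq_exp_norm:
  fixes u :: "'a::euclidean_space"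
  shows "(\<Prod>b\<in>Basis. std_normal_density (u \<bullet> b))
    = (1 / sqrt (2 * pi)) ^ DIM('a) * exp (- (norm u)\<^sup>2 / 2)"
proof -
  have "- (norm u)\<^sup>2 / 2 = (\<Sum>b\<in>Basis. - (u \<bullet> b)\<^sup>2 / 2)"
    by (simp add: norm_squared_eq_sum_coordinates sum_negf sum_divide_distrib)
  then show ?thesis
    by (simp only: std_normal_density_def prod.distrib prod_constant exp_sum[OF finite_Basis])
qed

lemma sets_std_gaussian[measurable_cong]: "sets std_gaussian = sets borel"
  by (simp add: std_gaussian_def)

lemma space_std_gaussian[simp]: "space std_gaussian = UNIV"
  by (simp add: std_gaussian_def)

lemma prob_space_std_gaussian: "prob_space (std_gaussian :: 'a::euclidean_space measure)"
proof
  have one: "(\<integral>\<^sup>+ x. ennreal (std_normal_density x) \<partial>lborel) = 1"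
    using prob_space.emeasure_space_1[OF prob_space_normal_density[of 1 0]]
    by (simp add: emeasure_density)
  have "emeasure (std_gaussian :: 'a measure) (space std_gaussian)
    = (\<integral>\<^sup>+ u. (\<Prod>b\<in>Basis. ennreal (std_normal_density (u \<bullet> b))) \<partial>(lborel :: 'a measure))"
    by (simp add: std_gaussian_def emeasure_density prod_ennreal)
  also have "\<dots> = 1"
    by (subst nn_integral_lborel_prod) (simp_all add: one)
  finally show "emeasure (std_gaussian :: 'a measure) (space std_gaussian) = 1" .
qed

interpretation std_gaussian: prob_space "std_gaussian :: 'a::euclidean_space measure"
  by (rule prob_space_std_gaussian)

text \<open>The Cameron--Martin formula. Lebesgue measure is translation invariant, so moving the
  centre of the Gaussian only changes the exponent, where expanding the square leaves the
  factor below.\<close>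

lemma distr_std_gaussian_translate:
  fixes v :: "'a::euclidean_space"
  shows "distr std_gaussian borel (\<lambda>u. u + v)
    = density std_gaussian (\<lambda>u. ennreal (exp (u \<bullet> v - (norm v)\<^sup>2 / 2)))"
proof (rule measure_eqI)
  fix A :: "'a set" assume "A \<in> sets (distr std_gaussian borel (\<lambda>u. u + v))"
  then have [measurable]: "A \<in> sets borel" by simp
  define p where "p u = (\<Prod>b\<in>Basis. std_normal_density (u \<bullet> b))" for u :: 'a
  have [measurable]: "p \<in> borel_measurable borel" unfolding p_def by measurable
  have p_shift: "p (u - v) = p u * exp (u \<bullet> v - (norm v)\<^sup>2 / 2)" for u
  proof -
    have "(norm (u - v))\<^sup>2 = (norm u)\<^sup>2 - 2 * (u \<bullet> v) + (norm v)\<^sup>2"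
      by (simp add: power2_norm_eq_inner inner_diff_left inner_diff_right inner_commute)
    then have "exp (- (norm (u - v))\<^sup>2 / 2)
        = exp (- (norm u)\<^sup>2 / 2) * exp (u \<bullet> v - (norm v)\<^sup>2 / 2)"
      by (simp add: exp_add[symmetric] field_simps)
    then show ?thesis
      by (simp add: p_def std_gaussian_density_eq_exp_norm)
  qed
  have "emeasure (distr std_gaussian borel (\<lambda>u. u + v)) A
      = (\<integral>\<^sup>+ u. indicator A (u + v) \<partial>std_gaussian)"
    by (subst nn_integral_indicator[symmetric], simp, subst nn_integral_distr) simp_all
  also have "\<dots> = (\<integral>\<^sup>+ u. ennreal (p u) * indicator A (u + v) \<partial>lborel)"
    by (simp add: std_gaussian_def p_def[symmetric] nn_integral_density)
  also have "\<dots> = (\<integral>\<^sup>+ u. ennreal (p ((v + u) - v)) * indicator A (v + u) \<partial>lborel)"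
    by (simp add: add.commute)
  also have "\<dots> = (\<integral>\<^sup>+ u. ennreal (p (u - v)) * indicator A u \<partial>distr lborel borel ((+) v))"
    by (subst nn_integral_distr) auto
  also have "\<dots> = (\<integral>\<^sup>+ u. ennreal (p u) * (ennreal (exp (u \<bullet> v - (norm v)\<^sup>2 / 2)) * indicator A u)
      \<partial>lborel)"
    unfolding lborel_distr_plus p_shift
    by (intro nn_integral_cong)
       (simp add: ennreal_mult p_def prod_nonneg mult.assoc)
  also have "\<dots> = emeasure (density std_gaussian (\<lambda>u. ennreal (exp (u \<bullet> v - (norm v)\<^sup>2 / 2)))) A"
    by (simp add: emeasure_density std_gaussian_def p_def[symmetric] nn_integral_density)
  finally show "emeasure (distr std_gaussian borel (\<lambda>u. u + v)) A
      = emeasure (density std_gaussian (\<lambda>u. ennreal (exp (u \<bullet> v - (norm v)\<^sup>2 / 2)))) A" .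
qed (simp add: std_gaussian_def)

lemma integral_std_gaussian_translate:
  fixes v :: "'a::euclidean_space" and g :: "'a \<Rightarrow> real"
  assumes [measurable]: "g \<in> borel_measurable borel"
  shows "(LINT u|std_gaussian. g (u + v))
    = (LINT u|std_gaussian. exp (u \<bullet> v - (norm v)\<^sup>2 / 2) * g u)"
proof -
  have "(LINT u|std_gaussian. g (u + v))
      = integral\<^sup>L (distr std_gaussian borel (\<lambda>u. u + v)) g"
    by (simp add: integral_distr)
  also have "\<dots> = (LINT u|std_gaussian. exp (u \<bullet> v - (norm v)\<^sup>2 / 2) * g u)"
    unfolding distr_std_gaussian_translate by (subst integral_density) auto
  finally show ?thesis .
qed

lemma integrable_exp_inner_std_gaussian:
  fixes v :: "'a::euclidean_space"
  shows "integrable std_gaussian (\<lambda>u. exp (u \<bullet> v))"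
proof -
  have "prob_space (distr std_gaussian borel (\<lambda>u. u + v))"
    by (rule std_gaussian.prob_space_distr) simp
  then have "prob_space (density std_gaussian (\<lambda>u. ennreal (exp (u \<bullet> v - (norm v)\<^sup>2 / 2))))"
    by (simp only: distr_std_gaussian_translate)
  from prob_space.emeasure_space_1[OF this]
  have "(\<integral>\<^sup>+ u. ennreal (exp (u \<bullet> v - (norm v)\<^sup>2 / 2)) \<partial>std_gaussian) = 1"
    by (simp add: emeasure_density)
  then have "integrable std_gaussian (\<lambda>u. exp (u \<bullet> v - (norm v)\<^sup>2 / 2))"
    by (intro integrableI_nonneg) auto
  then have "integrable std_gaussian
      (\<lambda>u. exp ((norm v)\<^sup>2 / 2) * exp (u \<bullet> v - (norm v)\<^sup>2 / 2))"
    by simp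
  then show ?thesis
    by (simp add: exp_add[symmetric])
qed

text \<open>The norm is at most the dimension times the largest coordinate in absolute value, so its
  exponential is dominated by finitely many exponentials of linear functions.\<close>

lemma integrable_exp_norm_std_gaussian:
  assumes "0 \<le> r"
  shows "integrable std_gaussian (\<lambda>u::'a::euclidean_space. exp (r * norm u))"
proof (rule Bochner_Integration.integrable_bound)
  define N where "N = real DIM('a)"
  let ?d = "\<lambda>u::'a. \<Sum>b\<in>Basis. exp (u \<bullet> ((r * N) *\<^sub>R b)) + exp (u \<bullet> ((- r * N) *\<^sub>R b))"
  show "integrable std_gaussian ?d"
    by (intro Bochner_Integration.integrable_sum Bochner_Integration.integrable_add
        integrable_exp_inner_std_gaussian)
  show "AE u in std_gaussian. norm (exp (r * norm u)) \<le> norm (?d u)"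
  proof (rule AE_I2)
    fix u :: 'a
    obtain b where b: "b \<in> Basis" and max: "\<And>b'. b' \<in> Basis \<Longrightarrow> \<bar>u \<bullet> b'\<bar> \<le> \<bar>u \<bullet> b\<bar>"
    proof -
      have "Max ((\<lambda>b. \<bar>u \<bullet> b\<bar>) ` Basis) \<in> (\<lambda>b. \<bar>u \<bullet> b\<bar>) ` Basis"
        by (intro Max_in) auto
      then obtain b where "b \<in> Basis" "Max ((\<lambda>b. \<bar>u \<bullet> b\<bar>) ` Basis) = \<bar>u \<bullet> b\<bar>"
        by blast
      moreover have "\<bar>u \<bullet> b'\<bar> \<le> Max ((\<lambda>b. \<bar>u \<bullet> b\<bar>) ` Basis)" if "b' \<in> Basis" for b'
        using that by (intro Max_ge) auto
      ultimately show thesis using that by metis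
    qed
    have "norm u \<le> (\<Sum>b\<in>Basis. \<bar>u \<bullet> b\<bar>)" by (rule norm_le_l1)
    also have "\<dots> \<le> N * \<bar>u \<bullet> b\<bar>"
      using sum_bounded_above[of Basis "\<lambda>b. \<bar>u \<bullet> b\<bar>" "\<bar>u \<bullet> b\<bar>"] max by (simp add: N_def)
    finally have "r * norm u \<le> r * (N * \<bar>u \<bullet> b\<bar>)" using assms by (rule mult_left_mono)
    then have "exp (r * norm u) \<le> exp (r * (N * \<bar>u \<bullet> b\<bar>))" by simp
    also have "\<dots> \<le> exp (u \<bullet> ((r * N) *\<^sub>R b)) + exp (u \<bullet> ((- r * N) *\<^sub>R b))"
      by (cases "0 \<le> u \<bullet> b") (auto simp: mult_ac)
    also have "\<dots> \<le> ?d u"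
      by (rule member_le_sum[OF b]) (auto intro: add_nonneg_nonneg)
    finally show "norm (exp (r * norm u)) \<le> norm (?d u)" by simp
  qed
qed simp

lemma integrable_std_gaussian_exp_growth:
  fixes g :: "'a::euclidean_space \<Rightarrow> 'b::{banach, second_countable_topology}"
  assumes "g \<in> borel_measurable borel" "0 \<le> r" "\<And>u. norm (g u) \<le> C * exp (r * norm u)"
  shows "integrable std_gaussian g"
proof (rule Bochner_Integration.integrable_bound)
  show "integrable std_gaussian (\<lambda>u::'a. C * exp (r * norm u))"
    using integrable_exp_norm_std_gaussian[OF assms(2), where 'a = 'a]
    by (rule integrable_mult_right)
  show "g \<in> borel_measurable std_gaussian" using assms(1) by simp
  show "AE u in std_gaussian. norm (g u) \<le> norm (C * exp (r * norm u))"
    using assms(3) by (intro AE_I2) (smt (verit) real_norm_def)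
qed

lemma le_exp: "x \<le> exp (x::real)"
  using exp_ge_add_one_self[of x] by linarith

lemma square_le_two_exp:
  assumes "0 \<le> x" shows "x\<^sup>2 \<le> 2 * exp (x::real)"
  using exp_lower_Taylor_quadratic[OF assms] assms by simp

lemma exp_first_order_remainder: "\<bar>exp x - 1 - x\<bar> \<le> x\<^sup>2 * exp \<bar>x\<bar>" for x :: real
proof -
  have "1 - x \<le> exp (- x)" using exp_ge_add_one_self[of "- x"] by simp
  then have "(1 - x) * exp x \<le> exp (- x) * exp x" by (intro mult_right_mono) auto
  then have "exp x - 1 \<le> x * exp x" by (simp add: exp_minus algebra_simps)
  then have upper: "exp x - 1 - x \<le> x * (exp x - 1)" by (simp add: algebra_simps)
  have "x * (exp x - 1) \<le> x\<^sup>2 * exp \<bar>x\<bar>"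
  proof (cases "0 \<le> x")
    case True
    then have "x * (exp x - 1) \<le> x * (x * exp x)"
      using \<open>exp x - 1 \<le> x * exp x\<close> by (intro mult_left_mono) auto
    then show ?thesis using True by (simp add: power2_eq_square)
  next
    case False
    then have "x * (exp x - 1) \<le> x * x"
      using exp_ge_add_one_self[of x] by (intro mult_left_mono_neg) linarith+
    also have "\<dots> \<le> x * x * exp \<bar>x\<bar>"
      using mult_left_mono[of 1 "exp \<bar>x\<bar>" "x * x"] by simp
    finally show ?thesis by (simp add: power2_eq_square)
  qed
  then show ?thesis using upper exp_ge_add_one_self[of x] by linarith
qed

text \<open>First-order expansion of the Cameron--Martin factor in the length of the translation, with
  an error that the Gaussian still integrates against functions of exponential growth.\<close>

lemma translation_factor_remainder:
  fixes a q s :: real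
  assumes "0 < s" "s \<le> 1" "0 \<le> q"
  shows "\<bar>exp (s * a - s\<^sup>2 * q) - 1 - s * a\<bar> \<le> s\<^sup>2 * (3 * exp (2 * (\<bar>a\<bar> + q)))"
proof -
  define y where "y = s * a - s\<^sup>2 * q"
  define B where "B = \<bar>a\<bar> + q"
  have B: "0 \<le> B" using assms by (simp add: B_def)
  have s2: "s\<^sup>2 \<le> s" using assms by (simp add: power2_eq_square mult_left_le)
  have "\<bar>y\<bar> \<le> \<bar>s * a\<bar> + \<bar>s\<^sup>2 * q\<bar>" unfolding y_def by (rule abs_triangle_ineq4)
  also have "\<dots> \<le> s * B"
    using s2 assms mult_right_mono[OF s2, of q] by (simp add: B_def abs_mult algebra_simps)
  finally have y: "\<bar>y\<bar> \<le> s * B" .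
  have "s * B \<le> B" using assms B by (simp add: mult_left_le_one_le)
  with y have "exp \<bar>y\<bar> \<le> exp B" by simp
  moreover have "y\<^sup>2 \<le> s\<^sup>2 * B\<^sup>2"
    using power_mono[OF y, of 2] by (simp add: power_mult_distrib)
  ultimately have "y\<^sup>2 * exp \<bar>y\<bar> \<le> (s\<^sup>2 * B\<^sup>2) * exp B" by (intro mult_mono) auto
  also have "\<dots> = s\<^sup>2 * (B\<^sup>2 * exp B)" by simp
  also have "\<dots> \<le> s\<^sup>2 * ((2 * exp B) * exp B)"
    using square_le_two_exp[OF B] by (intro mult_left_mono mult_right_mono) auto
  also have "\<dots> = s\<^sup>2 * (2 * exp (2 * B))" by (simp add: exp_add[symmetric])
  finally have 1: "\<bar>exp y - 1 - y\<bar> \<le> s\<^sup>2 * (2 * exp (2 * B))"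
    using exp_first_order_remainder[of y] by linarith
  have "q \<le> exp (2 * B)" using le_exp[of "2 * B"] assms by (simp add: B_def)
  then have "s\<^sup>2 * q \<le> s\<^sup>2 * exp (2 * B)" by (intro mult_left_mono) auto
  moreover have "\<bar>exp y - 1 - s * a\<bar> \<le> \<bar>exp y - 1 - y\<bar> + s\<^sup>2 * q"
  proof -
    have "0 \<le> s\<^sup>2 * q" using assms by simp
    then show ?thesis by (simp add: y_def)
  qed
  ultimately show ?thesis using 1 by (simp add: y_def B_def)
qed

section \<open>Stein's identity for functions with Lipschitz gradient\<close>

locale lipschitz_gradient =
  fixes f :: "'a::euclidean_space \<Rightarrow> real" and G :: "'a \<Rightarrow> 'a" and L :: real
  assumes GDERIV: "GDERIV f x :> G x"
    and lipschitz: "norm (G x - G y) \<le> L * norm (x - y)"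
    and L_nonneg: "0 \<le> L"
begin

lemma grad_eq: "grad f = G"
  using grad_eqI[OF GDERIV] by blast

lemma continuous_on_f: "continuous_on A f"
  using GDERIV unfolding gderiv_def
  by (meson has_derivative_continuous continuous_at_imp_continuous_on)

lemma continuous_on_G: "continuous_on A G"
  by (rule lipschitz_on_continuous_on[where L = L])
     (auto simp: lipschitz_on_def dist_norm lipschitz L_nonneg)

lemma measurable_f[measurable]: "f \<in> borel_measurable borel"
  and measurable_G[measurable]: "G \<in> borel_measurable borel"
  by (rule borel_measurable_continuous_onI continuous_on_f continuous_on_G)+

lemma taylor: "\<bar>f (x + d) - f x - G x \<bullet> d\<bar> \<le> L * (norm d)\<^sup>2"
proof -
  have "((\<lambda>\<tau>. f (x + \<tau> *\<^sub>R d)) has_derivative (\<lambda>\<epsilon>. (\<epsilon> *\<^sub>R d) \<bullet> G (x + \<tau> *\<^sub>R d)))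
      (at \<tau> within {0..1})" for \<tau>
    by (rule has_derivative_compose[where g = f, OF _ GDERIV[unfolded gderiv_def]])
       (auto intro!: derivative_eq_intros)
  from mvt_simple[of 0 1, OF _ this]
  obtain \<tau> where \<tau>: "0 < \<tau>" "\<tau> < 1" "f (x + d) - f x = d \<bullet> G (x + \<tau> *\<^sub>R d)"
    by auto
  have "\<bar>f (x + d) - f x - G x \<bullet> d\<bar> = \<bar>d \<bullet> (G (x + \<tau> *\<^sub>R d) - G x)\<bar>"
    by (simp add: \<tau> inner_diff_right inner_commute)
  also have "\<dots> \<le> norm d * norm (G (x + \<tau> *\<^sub>R d) - G x)" by (rule Cauchy_Schwarz_ineq2)
  also have "\<dots> \<le> norm d * (L * norm d)"
  proof (rule mult_left_mono)
    have "norm (G (x + \<tau> *\<^sub>R d) - G x) \<le> L * (\<tau> * norm d)"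
      using lipschitz[of "x + \<tau> *\<^sub>R d" x] \<tau> by simp
    also have "\<dots> \<le> L * norm d"
      using \<tau> L_nonneg by (intro mult_left_mono) (auto intro: mult_left_le_one_le)
    finally show "norm (G (x + \<tau> *\<^sub>R d) - G x) \<le> L * norm d" .
  qed simp
  finally show ?thesis by (simp add: power2_eq_square mult_ac)
qed

text \<open>The factor 1 in the exponents below gives both bounds the shape of the integrability
  criterion for the Gaussian measure.\<close>

lemma exp_growth_G: "norm (G u) \<le> (norm (G 0) + L) * exp (1 * norm u)"
proof -
  have "norm (G u) \<le> norm (G 0) + L * norm u"
    using lipschitz[of u 0] norm_triangle_sub[of "G u" "G 0"] by simp
  also have "\<dots> \<le> norm (G 0) * exp (norm u) + L * exp (norm u)"
    using mult_left_mono[of 1 "exp (norm u)" "norm (G 0)"] mult_left_mono[OF le_exp L_nonneg]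
    by (intro add_mono) auto
  finally show ?thesis by (simp add: algebra_simps)
qed

lemma exp_growth_f: "\<bar>f u\<bar> \<le> (\<bar>f 0\<bar> + norm (G 0) + 2 * L) * exp (1 * norm u)"
proof -
  have "\<bar>f u\<bar> \<le> \<bar>f 0\<bar> + \<bar>G 0 \<bullet> u\<bar> + L * (norm u)\<^sup>2"
    using taylor[of 0 u] by simp
  also have "\<dots> \<le> \<bar>f 0\<bar> * exp (norm u) + norm (G 0) * exp (norm u) + L * (2 * exp (norm u))"
  proof (intro add_mono)
    show "\<bar>f 0\<bar> \<le> \<bar>f 0\<bar> * exp (norm u)"
      using mult_left_mono[of 1 "exp (norm u)" "\<bar>f 0\<bar>"] by simp
    show "\<bar>G 0 \<bullet> u\<bar> \<le> norm (G 0) * exp (norm u)"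
      by (rule order_trans[OF Cauchy_Schwarz_ineq2 mult_left_mono[OF le_exp norm_ge_zero]])
    show "L * (norm u)\<^sup>2 \<le> L * (2 * exp (norm u))"
      by (intro mult_left_mono square_le_two_exp L_nonneg) simp
  qed
  finally show ?thesis by (simp add: algebra_simps)
qed

lemma integrable_f: "integrable std_gaussian f"
  and integrable_G: "integrable std_gaussian G"
  and integrable_f_scaleR: "integrable std_gaussian (\<lambda>u. f u *\<^sub>R u)"
proof -
  show "integrable std_gaussian f"
    by (rule integrable_std_gaussian_exp_growth[OF measurable_f _ exp_growth_f[folded real_norm_def]])
       simp
  show "integrable std_gaussian G"
    by (rule integrable_std_gaussian_exp_growth[OF measurable_G _ exp_growth_G]) simp
  define C where "C = \<bar>f 0\<bar> + norm (G 0) + 2 * L"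
  show "integrable std_gaussian (\<lambda>u. f u *\<^sub>R u)"
  proof (rule integrable_std_gaussian_exp_growth[where r = 2 and C = C])
    fix u
    have "\<bar>f u\<bar> * norm u \<le> (C * exp (norm u)) * exp (norm u)"
      using exp_growth_f[of u] by (intro mult_mono le_exp) (auto simp: C_def L_nonneg)
    also have "\<dots> = C * exp (2 * norm u)"
      using exp_add[of "norm u" "norm u"] by simp
    finally show "norm (f u *\<^sub>R u) \<le> C * exp (2 * norm u)" by simp
  qed auto
qed

lemma integrable_f_mult_inner: "integrable std_gaussian (\<lambda>u. f u * (u \<bullet> v))"
  using integrable_inner_left[of v std_gaussian "\<lambda>u. f u *\<^sub>R u"] integrable_f_scaleR by simp

text \<open>Stein's identity. The mean of \<open>f\<close> after a translation by \<open>s v\<close> can be computed in two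
  ways: by expanding \<open>f\<close>, or by moving the translation into the density. Both expansions are
  exact up to an error quadratic in \<open>s\<close>, so the two coefficients of \<open>s\<close> agree.\<close>

lemma stein: "(LINT u|std_gaussian. f u * (u \<bullet> v)) = (LINT u|std_gaussian. G u) \<bullet> v"
proof -
  define A where "A = (LINT u|std_gaussian. f u)"
  define B where "B = (LINT u|std_gaussian. f u * (u \<bullet> v))"
  define D where "D = (LINT u|std_gaussian. G u) \<bullet> v"
  define q where "q = (norm v)\<^sup>2 / 2"
  define E where "E u = \<bar>f u\<bar> * (3 * exp (2 * (\<bar>u \<bullet> v\<bar> + q)))" for u
  define F where "F s = (LINT u|std_gaussian. f (u + s *\<^sub>R v))" for s
  have D_eq: "D = (LINT u|std_gaussian. G u \<bullet> v)"
    unfolding D_def by (rule integral_inner_left[symmetric]) (rule integrable_G)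
  \<comment> \<open>Below, \<open>s\<^sup>2 E\<close> bounds the error of expanding the Cameron--Martin factor.\<close>
  have int_E: "integrable std_gaussian E"
  proof (rule integrable_std_gaussian_exp_growth)
    define C where "C = \<bar>f 0\<bar> + norm (G 0) + 2 * L"
    fix u
    have "\<bar>u \<bullet> v\<bar> \<le> norm v * norm u"
      using Cauchy_Schwarz_ineq2[of u v] by (simp add: mult.commute)
    then have "E u \<le> (C * exp (norm u)) * (3 * exp (2 * (norm v * norm u + q)))"
      unfolding E_def using exp_growth_f[of u] by (intro mult_mono) (auto simp: C_def L_nonneg)
    also have "\<dots> = (3 * C * exp (2 * q)) * exp ((2 * norm v + 1) * norm u)"
      by (simp add: exp_add[symmetric] algebra_simps)
    finally show "norm (E u) \<le> (3 * C * exp (2 * q)) * exp ((2 * norm v + 1) * norm u)"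
      by (simp add: E_def)
  qed (auto simp: E_def[abs_def])
  define K where "K = L * (norm v)\<^sup>2 + (LINT u|std_gaussian. E u)"
  have main: "s * \<bar>B - D\<bar> \<le> K * s\<^sup>2" if s: "0 < s" "s \<le> 1" for s
  proof -
    have shift: "lipschitz_gradient (\<lambda>u. f (u + s *\<^sub>R v)) (\<lambda>u. G (u + s *\<^sub>R v)) L"
    proof
      fix x y
      show "GDERIV (\<lambda>u. f (u + s *\<^sub>R v)) x :> G (x + s *\<^sub>R v)"
        unfolding gderiv_def
        by (rule has_derivative_compose[where g = f, OF _ GDERIV[unfolded gderiv_def]])
           (auto intro!: derivative_eq_intros)
      show "norm (G (x + s *\<^sub>R v) - G (y + s *\<^sub>R v)) \<le> L * norm (x - y)"
        using lipschitz[of "x + s *\<^sub>R v" "y + s *\<^sub>R v"] by simp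
    qed (rule L_nonneg)
    note int_shift = lipschitz_gradient.integrable_f[OF shift]
    have "\<bar>F s - A - s * D\<bar> = \<bar>LINT u|std_gaussian. f (u + s *\<^sub>R v) - f u - s * (G u \<bullet> v)\<bar>"
      unfolding F_def A_def D_eq using int_shift integrable_f integrable_G
      by simp
    also have "\<dots> \<le> (LINT u|std_gaussian. \<bar>f (u + s *\<^sub>R v) - f u - s * (G u \<bullet> v)\<bar>)"
      by (rule integral_abs_bound)
    also have "\<dots> \<le> (LINT u|(std_gaussian :: 'a measure). s\<^sup>2 * (L * (norm v)\<^sup>2))"
    proof (rule integral_mono)
      show "integrable std_gaussian (\<lambda>u. \<bar>f (u + s *\<^sub>R v) - f u - s * (G u \<bullet> v)\<bar>)"
        using int_shift integrable_f integrable_G by simp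
      show "\<bar>f (u + s *\<^sub>R v) - f u - s * (G u \<bullet> v)\<bar> \<le> s\<^sup>2 * (L * (norm v)\<^sup>2)" for u
        using taylor[of u "s *\<^sub>R v"] by (simp add: power_mult_distrib mult_ac)
    qed simp
    finally have 1: "\<bar>F s - A - s * D\<bar> \<le> s\<^sup>2 * (L * (norm v)\<^sup>2)"
      using std_gaussian.prob_space[where 'a = 'a] by simp
    let ?w = "\<lambda>u. exp (s * (u \<bullet> v) - s\<^sup>2 * q)"
    have F_eq: "F s = (LINT u|std_gaussian. ?w u * f u)"
      unfolding F_def
      by (subst integral_std_gaussian_translate) (simp_all add: q_def power_mult_distrib)
    have bound: "\<bar>?w u * f u - f u - s * (f u * (u \<bullet> v))\<bar> \<le> s\<^sup>2 * E u" for u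
    proof -
      have "\<bar>?w u * f u - f u - s * (f u * (u \<bullet> v))\<bar>
          = \<bar>f u\<bar> * \<bar>?w u - 1 - s * (u \<bullet> v)\<bar>"
        by (simp add: abs_mult[symmetric] algebra_simps)
      also have "\<dots> \<le> \<bar>f u\<bar> * (s\<^sup>2 * (3 * exp (2 * (\<bar>u \<bullet> v\<bar> + q))))"
        using s by (intro mult_left_mono translation_factor_remainder) (auto simp: q_def)
      finally show ?thesis by (simp add: E_def mult_ac)
    qed
    have int_diff: "integrable std_gaussian (\<lambda>u. ?w u * f u - f u - s * (f u * (u \<bullet> v)))"
    proof (rule Bochner_Integration.integrable_bound)
      show "integrable std_gaussian (\<lambda>u. s\<^sup>2 * E u)" using int_E by simp
      show "AE u in std_gaussian. norm (?w u * f u - f u - s * (f u * (u \<bullet> v)))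
          \<le> norm (s\<^sup>2 * E u)"
        using bound by (intro AE_I2) (smt (verit) real_norm_def)
    qed measurable
    \<comment> \<open>The translated integrand is integrable because its expansion and the remainder are.\<close>
    have "integrable std_gaussian
        (\<lambda>u. (?w u * f u - f u - s * (f u * (u \<bullet> v))) + f u + s * (f u * (u \<bullet> v)))"
      using int_diff integrable_f integrable_f_mult_inner
      by (intro Bochner_Integration.integrable_add) auto
    then have int_w: "integrable std_gaussian (\<lambda>u. ?w u * f u)" by simp
    have "\<bar>F s - A - s * B\<bar> = \<bar>LINT u|std_gaussian. ?w u * f u - f u - s * (f u * (u \<bullet> v))\<bar>"
      unfolding F_eq A_def B_def using int_w integrable_f integrable_f_mult_inner by simp
    also have "\<dots> \<le> (LINT u|std_gaussian. \<bar>?w u * f u - f u - s * (f u * (u \<bullet> v))\<bar>)"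
      by (rule integral_abs_bound)
    also have "\<dots> \<le> (LINT u|std_gaussian. s\<^sup>2 * E u)"
      using int_diff int_E bound by (intro integral_mono) auto
    finally have 2: "\<bar>F s - A - s * B\<bar> \<le> s\<^sup>2 * (LINT u|std_gaussian. E u)"
      by simp
    have "\<bar>s * B - s * D\<bar> \<le> s\<^sup>2 * (L * (norm v)\<^sup>2) + s\<^sup>2 * (LINT u|std_gaussian. E u)"
      using 1 2 by linarith
    moreover have "\<bar>s * B - s * D\<bar> = s * \<bar>B - D\<bar>"
      using s by (simp add: right_diff_distrib[symmetric] abs_mult)
    ultimately show ?thesis by (simp add: K_def algebra_simps)
  qed
  \<comment> \<open>Divide by \<open>s\<close> and let it tend to 0.\<close>
  have "\<bar>B - D\<bar> \<le> 0"
  proof (rule field_le_epsilon)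
    fix e :: real assume e: "0 < e"
    define s where "s = min 1 (e / (\<bar>K\<bar> + 1))"
    have s: "0 < s" "s \<le> 1" using e by (auto simp: s_def)
    have "\<bar>B - D\<bar> \<le> K * s" using main[OF s] s by (simp add: power2_eq_square)
    also have "\<dots> \<le> (\<bar>K\<bar> + 1) * s" using s by (intro mult_right_mono) auto
    also have "\<dots> \<le> (\<bar>K\<bar> + 1) * (e / (\<bar>K\<bar> + 1))"
      by (intro mult_left_mono) (auto simp: s_def)
    also have "\<dots> = e" by simp
    finally show "\<bar>B - D\<bar> \<le> 0 + e" by simp
  qed
  then show ?thesis by (simp add: B_def D_def)
qed

lemma stein_vector: "(LINT u|std_gaussian. f u *\<^sub>R u) = (LINT u|std_gaussian. G u)"
proof -
  have "(LINT u|std_gaussian. f u *\<^sub>R u) \<bullet> v = (LINT u|std_gaussian. G u) \<bullet> v" for v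
    using stein[of v] integral_inner_left[of v std_gaussian "\<lambda>u. f u *\<^sub>R u"]
    by (simp add: integrable_f_scaleR)
  then show ?thesis by (metis vector_eq_rdot)
qed

end

section \<open>Gaussian smoothing and the two-point oracle\<close>

lemma (in prob_space) square_integrable_norm:
  fixes X :: "'a \<Rightarrow> 'b::euclidean_space"
  assumes [measurable]: "X \<in> borel_measurable M"
    and sq: "integrable M (\<lambda>\<omega>. (norm (X \<omega>))\<^sup>2)"
  shows square_integrable_norm_imp_integrable: "integrable M X"
    and expectation_norm_le_sqrt: "(LINT \<omega>|M. norm (X \<omega>)) \<le> sqrt (LINT \<omega>|M. (norm (X \<omega>))\<^sup>2)"
proof -
  have norm: "integrable M (\<lambda>\<omega>. norm (X \<omega>))"
    by (rule square_integrable_imp_integrable) (use sq in auto)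
  then show "integrable M X" by (simp add: integrable_norm_iff)
  have "variance (\<lambda>\<omega>. norm (X \<omega>))
      = (LINT \<omega>|M. (norm (X \<omega>))\<^sup>2) - (LINT \<omega>|M. norm (X \<omega>))\<^sup>2"
    by (rule variance_eq[OF norm]) (use sq in simp)
  then have "(LINT \<omega>|M. norm (X \<omega>))\<^sup>2 \<le> (LINT \<omega>|M. (norm (X \<omega>))\<^sup>2)"
    using variance_positive[of "\<lambda>\<omega>. norm (X \<omega>)"] by linarith
  then show "(LINT \<omega>|M. norm (X \<omega>)) \<le> sqrt (LINT \<omega>|M. (norm (X \<omega>))\<^sup>2)"
    by (rule real_le_rsqrt)
qed

text \<open>Stein's identity applied to a linear function.\<close>

lemma std_gaussian_second_moment:
  fixes v :: "'a::euclidean_space"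
  shows "integrable std_gaussian (\<lambda>u. (u \<bullet> v)\<^sup>2)"
    and "(LINT u|std_gaussian. (u \<bullet> v)\<^sup>2) = (norm v)\<^sup>2"
proof -
  interpret lipschitz_gradient "\<lambda>u. u \<bullet> v" "\<lambda>_. v" 0
    by standard (auto simp: gderiv_def intro!: derivative_eq_intros)
  show "integrable std_gaussian (\<lambda>u. (u \<bullet> v)\<^sup>2)"
    using integrable_f_mult_inner[of v] by (simp add: power2_eq_square)
  show "(LINT u|std_gaussian. (u \<bullet> v)\<^sup>2) = (norm v)\<^sup>2"
    using stein[of v] std_gaussian.prob_space[where 'a = 'a]
    by (simp add: power2_eq_square[symmetric] power2_norm_eq_inner)
qed

lemma expectation_norm_std_gaussian:
  shows "integrable std_gaussian (\<lambda>u::'a::euclidean_space. norm u)"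
    and "(LINT u|std_gaussian. norm (u::'a)) \<le> sqrt (real DIM('a))"
proof -
  have sq: "integrable std_gaussian (\<lambda>u::'a. (norm u)\<^sup>2)"
    unfolding norm_squared_eq_sum_coordinates by (intro Bochner_Integration.integrable_sum std_gaussian_second_moment)
  have "(LINT u|std_gaussian. (norm (u::'a))\<^sup>2) = real DIM('a)"
    unfolding norm_squared_eq_sum_coordinates
    by (simp add: Bochner_Integration.integral_sum std_gaussian_second_moment)
  then show "(LINT u|std_gaussian. norm (u::'a)) \<le> sqrt (real DIM('a))"
    using std_gaussian.expectation_norm_le_sqrt[OF _ sq] by simp
  show "integrable std_gaussian (\<lambda>u::'a. norm u)"
    using std_gaussian.square_integrable_norm_imp_integrable[OF _ sq] by simp
qed

context lipschitz_gradient
begin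

text \<open>The scalar factor of the oracle is itself a function with Lipschitz gradient in the
  direction \<open>u\<close>, so Stein's identity applies to it.\<close>

lemma lipschitz_gradient_difference_quotient:
  assumes "0 < \<mu>"
  shows "lipschitz_gradient (\<lambda>u. (f (x + \<mu> *\<^sub>R u) - f x) / \<mu>) (\<lambda>u. G (x + \<mu> *\<^sub>R u)) (\<mu> * L)"
proof
  fix y z
  have "((\<lambda>u. f (x + \<mu> *\<^sub>R u)) has_derivative (\<lambda>d. (\<mu> *\<^sub>R d) \<bullet> G (x + \<mu> *\<^sub>R y))) (at y)"
    by (rule has_derivative_compose[where g = f, OF _ GDERIV[unfolded gderiv_def]])
       (auto intro!: derivative_eq_intros)
  then have "((\<lambda>u. (f (x + \<mu> *\<^sub>R u) - f x) / \<mu>) has_derivative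
      (\<lambda>d. (\<mu> *\<^sub>R d) \<bullet> G (x + \<mu> *\<^sub>R y) / \<mu>)) (at y)"
    using assms by (auto intro!: derivative_eq_intros)
  then show "GDERIV (\<lambda>u. (f (x + \<mu> *\<^sub>R u) - f x) / \<mu>) y :> G (x + \<mu> *\<^sub>R y)"
    using assms by (simp add: gderiv_def)
  have "norm (G (x + \<mu> *\<^sub>R y) - G (x + \<mu> *\<^sub>R z)) \<le> L * norm ((x + \<mu> *\<^sub>R y) - (x + \<mu> *\<^sub>R z))"
    by (rule lipschitz)
  also have "(x + \<mu> *\<^sub>R y) - (x + \<mu> *\<^sub>R z) = \<mu> *\<^sub>R (y - z)"
    by (simp add: scaleR_diff_right)
  finally show "norm (G (x + \<mu> *\<^sub>R y) - G (x + \<mu> *\<^sub>R z)) \<le> \<mu> * L * norm (y - z)"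
    using assms by (simp add: mult_ac)
qed (use assms L_nonneg in simp)

definition smoothed_gradient :: "real \<Rightarrow> 'a \<Rightarrow> 'a" where
  "smoothed_gradient \<mu> x = (LINT u|std_gaussian. G (x + \<mu> *\<^sub>R u))"

lemma
  assumes "0 < \<mu>"
  shows integrable_G_shifted: "integrable std_gaussian (\<lambda>u. G (x + \<mu> *\<^sub>R u))"
    and integrable_f_shifted: "integrable std_gaussian (\<lambda>u. f (x + \<mu> *\<^sub>R u))"
    and integrable_zo_oracle: "integrable std_gaussian (zo_oracle f \<mu> x)"
    and expectation_zo_oracle: "(LINT u|std_gaussian. zo_oracle f \<mu> x u) = smoothed_gradient \<mu> x"
proof -
  interpret Q: lipschitz_gradient "\<lambda>u. (f (x + \<mu> *\<^sub>R u) - f x) / \<mu>" "\<lambda>u. G (x + \<mu> *\<^sub>R u)" "\<mu> * L"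
    using assms by (rule lipschitz_gradient_difference_quotient)
  show "integrable std_gaussian (\<lambda>u. G (x + \<mu> *\<^sub>R u))" by (rule Q.integrable_G)
  have "integrable std_gaussian (\<lambda>u. \<mu> * ((f (x + \<mu> *\<^sub>R u) - f x) / \<mu>) + f x)"
    using Q.integrable_f by (intro Bochner_Integration.integrable_add integrable_mult_right) auto
  then show "integrable std_gaussian (\<lambda>u. f (x + \<mu> *\<^sub>R u))" using assms by simp
  show "integrable std_gaussian (zo_oracle f \<mu> x)"
    unfolding zo_oracle_def[abs_def] by (rule Q.integrable_f_scaleR)
  show "(LINT u|std_gaussian. zo_oracle f \<mu> x u) = smoothed_gradient \<mu> x"
    unfolding zo_oracle_def smoothed_gradient_def by (rule Q.stein_vector)
qed

text \<open>The second-order Taylor error of \<open>f\<close> is uniform in the base point, so it is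
  also the error of the averaged function.\<close>

lemma GDERIV_gaussian_smoothing:
  assumes "0 < \<mu>"
  shows "GDERIV (gaussian_smoothing \<mu> f) x :> smoothed_gradient \<mu> x"
proof -
  let ?F = "gaussian_smoothing \<mu> f"
  have quadratic: "\<bar>?F y - ?F x - (y - x) \<bullet> smoothed_gradient \<mu> x\<bar> \<le> L * (norm (y - x))\<^sup>2" for y
  proof -
    let ?r = "\<lambda>u. f (y + \<mu> *\<^sub>R u) - f (x + \<mu> *\<^sub>R u) - G (x + \<mu> *\<^sub>R u) \<bullet> (y - x)"
    note int = integrable_f_shifted[OF assms] integrable_G_shifted[OF assms]
    have "\<bar>?F y - ?F x - (y - x) \<bullet> smoothed_gradient \<mu> x\<bar> = \<bar>LINT u|std_gaussian. ?r u\<bar>"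
      using int by (simp add: gaussian_smoothing_def smoothed_gradient_def inner_commute)
    also have "\<dots> \<le> (LINT u|std_gaussian. \<bar>?r u\<bar>)" by (rule integral_abs_bound)
    also have "\<dots> \<le> (LINT u|(std_gaussian::'a measure). L * (norm (y - x))\<^sup>2)"
    proof (rule integral_mono)
      show "integrable std_gaussian (\<lambda>u. \<bar>?r u\<bar>)" using int by simp
      show "\<bar>?r u\<bar> \<le> L * (norm (y - x))\<^sup>2" for u
        using taylor[of "x + \<mu> *\<^sub>R u" "y - x"] by (simp add: add.commute)
    qed simp
    also have "\<dots> = L * (norm (y - x))\<^sup>2" using std_gaussian.prob_space[where 'a = 'a] by simp
    finally show ?thesis .
  qed
  show ?thesis
    unfolding gderiv_def
  proof (rule has_derivativeI_sandwich[of 1])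
    show "bounded_linear (\<lambda>h. h \<bullet> smoothed_gradient \<mu> x)" by (rule bounded_linear_inner_left)
    show "((\<lambda>y. L * norm (y - x)) \<longlongrightarrow> 0) (at x)"
      by (auto intro!: tendsto_eq_intros)
    fix y assume "y \<noteq> x"
    then show "norm (?F y - ?F x - (y - x) \<bullet> smoothed_gradient \<mu> x) / norm (y - x)
        \<le> L * norm (y - x)"
      using quadratic[of y] by (simp add: divide_le_eq power2_eq_square mult_ac)
  qed simp
qed

lemma lipschitz_smoothed_gradient:
  assumes "0 < \<mu>"
  shows "norm (smoothed_gradient \<mu> x - smoothed_gradient \<mu> y) \<le> L * norm (x - y)"
proof -
  note int = integrable_G_shifted[OF assms]
  have "norm (smoothed_gradient \<mu> x - smoothed_gradient \<mu> y)
      = norm (LINT u|std_gaussian. G (x + \<mu> *\<^sub>R u) - G (y + \<mu> *\<^sub>R u))"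
    using int by (simp add: smoothed_gradient_def)
  also have "\<dots> \<le> (LINT u|std_gaussian. norm (G (x + \<mu> *\<^sub>R u) - G (y + \<mu> *\<^sub>R u)))"
    by (rule integral_norm_bound)
  also have "\<dots> \<le> (LINT u|(std_gaussian::'a measure). L * norm (x - y))"
  proof (rule integral_mono)
    show "norm (G (x + \<mu> *\<^sub>R u) - G (y + \<mu> *\<^sub>R u)) \<le> L * norm (x - y)" for u
      using lipschitz[of "x + \<mu> *\<^sub>R u" "y + \<mu> *\<^sub>R u"] by simp
  qed (use int in simp_all)
  also have "\<dots> = L * norm (x - y)" using std_gaussian.prob_space[where 'a = 'a] by simp
  finally show ?thesis .
qed

text \<open>The argument moves by \<open>\<mu> u\<close>, whose mean length is at most \<open>\<mu> \<surd>n\<close>; this is well below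
  the stated bound, which has the customary form for the smoothing bias.\<close>

lemma smoothing_bias:
  assumes "0 < \<mu>"
  shows "norm (smoothed_gradient \<mu> x - G x) \<le> \<mu> / 2 * L * (real DIM('a) + 3) powr (3 / 2)"
proof -
  define n where "n = real DIM('a)"
  note int = integrable_G_shifted[OF assms]
  have "norm (smoothed_gradient \<mu> x - G x) = norm (LINT u|std_gaussian. G (x + \<mu> *\<^sub>R u) - G x)"
    using int std_gaussian.prob_space[where 'a = 'a] by (simp add: smoothed_gradient_def)
  also have "\<dots> \<le> (LINT u|std_gaussian. norm (G (x + \<mu> *\<^sub>R u) - G x))"
    by (rule integral_norm_bound)
  also have "\<dots> \<le> (LINT u|std_gaussian. (L * \<mu>) * norm (u::'a))"
  proof (rule integral_mono)
    show "norm (G (x + \<mu> *\<^sub>R u) - G x) \<le> (L * \<mu>) * norm u" for u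
      using lipschitz[of "x + \<mu> *\<^sub>R u" x] assms by simp
  qed (use int expectation_norm_std_gaussian(1) in \<open>auto intro: integrable_mult_right\<close>)
  also have "\<dots> = (L * \<mu>) * (LINT u|std_gaussian. norm (u::'a))" by simp
  also have "\<dots> \<le> (L * \<mu>) * sqrt n"
    unfolding n_def using assms L_nonneg expectation_norm_std_gaussian(2)
    by (intro mult_left_mono) auto
  also have "\<dots> \<le> (L * \<mu>) * ((n + 3) powr (3 / 2) / 2)"
  proof (rule mult_left_mono)
    have "(n + 3) powr (3 / 2) = (n + 3) powr (1 + 1 / 2)" by simp
    also have "\<dots> = (n + 3) * sqrt (n + 3)"
      unfolding powr_add by (simp add: n_def powr_half_sqrt)
    finally have eq: "(n + 3) powr (3 / 2) = (n + 3) * sqrt (n + 3)" .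
    have "2 * sqrt n \<le> (n + 3) * sqrt (n + 3)" by (intro mult_mono) (auto simp: n_def)
    then show "sqrt n \<le> (n + 3) powr (3 / 2) / 2" by (simp add: eq)
  qed (use assms L_nonneg in simp)
  finally show ?thesis by (simp add: n_def mult_ac)
qed

end

section \<open>Independent centred noise in mean square\<close>

text \<open>The mean is the best constant approximation in mean square.\<close>

lemma (in prob_space) expectation_dist_mean_le:
  fixes X :: "'a \<Rightarrow> 'b::euclidean_space"
  assumes [measurable]: "X \<in> borel_measurable M"
    and sq: "integrable M (\<lambda>\<omega>. (norm (X \<omega> - a))\<^sup>2)"
  shows "integrable M (\<lambda>\<omega>. (norm (X \<omega> - b))\<^sup>2)"
    and "(LINT \<omega>|M. (norm (X \<omega> - expectation X))\<^sup>2) \<le> (LINT \<omega>|M. (norm (X \<omega> - a))\<^sup>2)"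
proof -
  have int': "integrable M (\<lambda>\<omega>. X \<omega> - a)"
    by (rule square_integrable_norm_imp_integrable[OF _ sq]) simp
  then have "integrable M (\<lambda>\<omega>. X \<omega> - a + a)" by (intro Bochner_Integration.integrable_add) auto
  then have int: "integrable M X" by simp
  have expand: "(norm (X \<omega> - b))\<^sup>2 = (norm (X \<omega> - a))\<^sup>2 + (2 * ((X \<omega> - a) \<bullet> (a - b)) + (norm (a - b))\<^sup>2)"
    for \<omega> b
    by (simp add: power2_norm_eq_inner inner_diff_left inner_diff_right inner_commute)
  show "integrable M (\<lambda>\<omega>. (norm (X \<omega> - b))\<^sup>2)" for b
    unfolding expand[of _ b] using sq int' by (intro Bochner_Integration.integrable_add) auto
  let ?m = "expectation X"
  have "(LINT \<omega>|M. (norm (X \<omega> - ?m))\<^sup>2)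
      = (LINT \<omega>|M. (norm (X \<omega> - a))\<^sup>2) + (2 * ((?m - a) \<bullet> (a - ?m)) + (norm (a - ?m))\<^sup>2)"
    unfolding expand[of _ ?m] using sq int' int by (simp add: prob_space)
  also have "(?m - a) \<bullet> (a - ?m) = - (norm (a - ?m))\<^sup>2"
    by (simp add: power2_norm_eq_inner inner_diff_left inner_diff_right inner_commute)
  finally show "(LINT \<omega>|M. (norm (X \<omega> - ?m))\<^sup>2) \<le> (LINT \<omega>|M. (norm (X \<omega> - a))\<^sup>2)"
    by simp
qed

text \<open>Noise that is centred conditionally on the past is orthogonal to every square-integrable
  function of the past, so mean squares add. By independence the joint law of past and noise is
  a product, and Fubini's theorem turns the conditional statement into an integral over the
  noise for a fixed past.\<close>

lemma (in prob_space) add_centred_noise: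
  fixes P :: "'b \<Rightarrow> 'd::euclidean_space" and e :: "'b \<Rightarrow> 'b \<Rightarrow> 'd"
  assumes indep: "indep_var N Y K X"
    and [measurable]: "P \<in> borel_measurable N" "case_prod e \<in> borel_measurable (N \<Otimes>\<^sub>M K)"
    and sq: "integrable M (\<lambda>\<omega>. (norm (P (Y \<omega>)))\<^sup>2)"
    and var: "\<And>y. y \<in> space N \<Longrightarrow> (\<integral>\<^sup>+ x. ennreal ((norm (e y x))\<^sup>2) \<partial>distr M K X) \<le> ennreal s"
    and centred: "\<And>y. y \<in> space N \<Longrightarrow> (LINT x|distr M K X. e y x) = 0"
    and "0 \<le> s"
  shows "integrable M (\<lambda>\<omega>. (norm (P (Y \<omega>) + e (Y \<omega>) (X \<omega>)))\<^sup>2)"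
    and "(LINT \<omega>|M. (norm (P (Y \<omega>) + e (Y \<omega>) (X \<omega>)))\<^sup>2) \<le> (LINT \<omega>|M. (norm (P (Y \<omega>)))\<^sup>2) + s"
    and "(LINT \<omega>|M. P (Y \<omega>) + e (Y \<omega>) (X \<omega>)) = (LINT \<omega>|M. P (Y \<omega>))"
proof -
  have Y[measurable]: "Y \<in> measurable M N" and X[measurable]: "X \<in> measurable M K"
    using indep by (auto dest: indep_var_rv1 indep_var_rv2)
  let ?J = "distr M N Y \<Otimes>\<^sub>M distr M K X"
  have J: "distr M (N \<Otimes>\<^sub>M K) (\<lambda>\<omega>. (Y \<omega>, X \<omega>)) = ?J"
    using indep unfolding indep_var_distribution_eq by simp
  interpret DY: prob_space "distr M N Y" by (rule prob_space_distr) simp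
  interpret DX: prob_space "distr M K X" by (rule prob_space_distr) simp
  interpret J: pair_prob_space "distr M N Y" "distr M K X" ..
  note [measurable_cong] = sets_distr[of M N Y] sets_distr[of M K X]
  have e_y[measurable]: "e y \<in> borel_measurable K" if "y \<in> space N" for y
    using measurable_compose[OF measurable_Pair1'[OF that] assms(3)] by simp
  have e_M[measurable]: "(\<lambda>\<omega>. e (Y \<omega>) (X \<omega>)) \<in> borel_measurable M"
    using measurable_compose[OF measurable_Pair[OF Y X] assms(3)] by simp
  have P_M[measurable]: "(\<lambda>\<omega>. P (Y \<omega>)) \<in> borel_measurable M" by simp
  have "(\<integral>\<^sup>+ \<omega>. ennreal ((norm (e (Y \<omega>) (X \<omega>)))\<^sup>2) \<partial>M)
      = (\<integral>\<^sup>+ z. ennreal ((norm (case_prod e z))\<^sup>2) \<partial>?J)"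
    unfolding J[symmetric] by (subst nn_integral_distr) auto
  also have "\<dots> = (\<integral>\<^sup>+ y. \<integral>\<^sup>+ x. ennreal ((norm (e y x))\<^sup>2) \<partial>distr M K X \<partial>distr M N Y)"
    by (subst DX.nn_integral_fst[symmetric]) auto
  also have "\<dots> \<le> (\<integral>\<^sup>+ y. ennreal s \<partial>distr M N Y)"
    by (rule nn_integral_mono) (auto intro: var)
  also have "\<dots> = ennreal s"
    using DY.emeasure_space_1 by simp
  finally have nn_e: "(\<integral>\<^sup>+ \<omega>. ennreal ((norm (e (Y \<omega>) (X \<omega>)))\<^sup>2) \<partial>M) \<le> ennreal s" .
  then have sq_e: "integrable M (\<lambda>\<omega>. (norm (e (Y \<omega>) (X \<omega>)))\<^sup>2)"
    by (intro integrableI_nonneg) (auto intro: le_less_trans)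
  then have "ennreal (LINT \<omega>|M. (norm (e (Y \<omega>) (X \<omega>)))\<^sup>2) \<le> ennreal s"
    using nn_e by (subst nn_integral_eq_integral[symmetric]) auto
  then have E_e: "(LINT \<omega>|M. (norm (e (Y \<omega>) (X \<omega>)))\<^sup>2) \<le> s" using \<open>0 \<le> s\<close> by simp
  have int_e: "integrable M (\<lambda>\<omega>. e (Y \<omega>) (X \<omega>))"
    by (rule square_integrable_norm_imp_integrable[OF _ sq_e]) simp
  have int_P: "integrable M (\<lambda>\<omega>. P (Y \<omega>))"
    by (rule square_integrable_norm_imp_integrable[OF _ sq]) simp
  have int_Pe: "integrable M (\<lambda>\<omega>. P (Y \<omega>) \<bullet> e (Y \<omega>) (X \<omega>))"
  proof (rule Bochner_Integration.integrable_bound)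
    show "integrable M (\<lambda>\<omega>. (norm (P (Y \<omega>)))\<^sup>2 + (norm (e (Y \<omega>) (X \<omega>)))\<^sup>2)"
      using sq sq_e by (rule Bochner_Integration.integrable_add)
    have "\<bar>a \<bullet> b\<bar> \<le> (norm a)\<^sup>2 + (norm b)\<^sup>2" for a b :: 'd
    proof -
      have "2 * (norm a * norm b) \<le> (norm a)\<^sup>2 + (norm b)\<^sup>2"
        using zero_le_power2[of "norm a - norm b"] by (simp add: power2_diff)
      moreover have "0 \<le> norm a * norm b" by simp
      ultimately show ?thesis using Cauchy_Schwarz_ineq2[of a b] by linarith
    qed
    then show "AE \<omega> in M. norm (P (Y \<omega>) \<bullet> e (Y \<omega>) (X \<omega>))
        \<le> norm ((norm (P (Y \<omega>)))\<^sup>2 + (norm (e (Y \<omega>) (X \<omega>)))\<^sup>2)"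
      by simp
  qed simp
  have sq_int_y: "integrable (distr M K X) (e y)" if y: "y \<in> space N" for y
  proof (rule DX.square_integrable_norm_imp_integrable)
    show "integrable (distr M K X) (\<lambda>x. (norm (e y x))\<^sup>2)"
      using var[OF y] y by (intro integrableI_nonneg) (auto intro: le_less_trans)
  qed (use y in simp)
  have int_J: "integrable ?J (\<lambda>z. case_prod e z)"
    unfolding J[symmetric] using int_e by (subst integrable_distr_eq) auto
  have "(LINT \<omega>|M. e (Y \<omega>) (X \<omega>)) = integral\<^sup>L ?J (\<lambda>z. case_prod e z)"
    unfolding J[symmetric] by (subst integral_distr) auto
  also have "\<dots> = (LINT y|distr M N Y. LINT x|distr M K X. e y x)"
    using J.integral_fst'[OF int_J] by simp
  also have "\<dots> = (LINT y|distr M N Y. 0)"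
    by (rule Bochner_Integration.integral_cong) (auto simp: centred)
  finally have E0: "(LINT \<omega>|M. e (Y \<omega>) (X \<omega>)) = 0" by simp
  have int_JPe: "integrable ?J (\<lambda>(y, x). P y \<bullet> e y x)"
    unfolding J[symmetric] using int_Pe by (subst integrable_distr_eq) auto
  have "(LINT \<omega>|M. P (Y \<omega>) \<bullet> e (Y \<omega>) (X \<omega>)) = integral\<^sup>L ?J (\<lambda>(y, x). P y \<bullet> e y x)"
    unfolding J[symmetric] by (subst integral_distr) auto
  also have "\<dots> = (LINT y|distr M N Y. LINT x|distr M K X. P y \<bullet> e y x)"
    using J.integral_fst'[OF int_JPe] by simp
  also have "\<dots> = (LINT y|distr M N Y. 0)"
    by (rule Bochner_Integration.integral_cong)
       (auto simp: centred integral_inner_right[OF sq_int_y])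
  finally have orth: "(LINT \<omega>|M. P (Y \<omega>) \<bullet> e (Y \<omega>) (X \<omega>)) = 0" by simp
  have expand: "(norm (P (Y \<omega>) + e (Y \<omega>) (X \<omega>)))\<^sup>2
      = ((norm (P (Y \<omega>)))\<^sup>2 + (norm (e (Y \<omega>) (X \<omega>)))\<^sup>2) + 2 * (P (Y \<omega>) \<bullet> e (Y \<omega>) (X \<omega>))" for \<omega>
    by (simp add: power2_norm_eq_inner inner_add_left inner_add_right inner_commute)
  show "integrable M (\<lambda>\<omega>. (norm (P (Y \<omega>) + e (Y \<omega>) (X \<omega>)))\<^sup>2)"
    unfolding expand using sq sq_e int_Pe by simp
  show "(LINT \<omega>|M. (norm (P (Y \<omega>) + e (Y \<omega>) (X \<omega>)))\<^sup>2) \<le> (LINT \<omega>|M. (norm (P (Y \<omega>)))\<^sup>2) + s"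
    unfolding expand using sq sq_e int_Pe E_e orth by simp
  show "(LINT \<omega>|M. P (Y \<omega>) + e (Y \<omega>) (X \<omega>)) = (LINT \<omega>|M. P (Y \<omega>))"
    using int_P int_e E0 by simp
qed

section \<open>Mean and fluctuation of the stochastic iterates\<close>

lemma zo_iterate_cong:
  assumes "\<And>j i. j < k \<Longrightarrow> i < t \<Longrightarrow> U j i \<omega> = U' j i \<omega>'"
  shows "zo_iterate c h f \<mu> t U z0 k \<omega> = zo_iterate c h f \<mu> t U' z0 k \<omega>'"
  using assms
proof (induction k)
  case (Suc k)
  then have "zo_iterate c h f \<mu> t U z0 k \<omega> = zo_iterate c h f \<mu> t U' z0 k \<omega>'" by simp
  moreover have "zo_gradient f \<mu> t x (\<lambda>i. U k i \<omega>) = zo_gradient f \<mu> t x (\<lambda>i. U' k i \<omega>')" for x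
    unfolding zo_gradient_def using Suc.prems by (auto intro!: sum.cong)
  ultimately show ?case by simp
qed simp

lemma measurable_zo_iterate:
  fixes f :: "'a::euclidean_space \<Rightarrow> real"
  assumes [measurable]: "f \<in> borel_measurable borel"
    and "\<And>j i. j < k \<Longrightarrow> i < t \<Longrightarrow> U j i \<in> borel_measurable N"
  shows "zo_iterate c h f \<mu> t U z0 k \<in> borel_measurable N"
  using assms(2)
proof (induction k)
  case 0
  have "zo_iterate c h f \<mu> t U z0 0 = (\<lambda>_. z0)" by (rule ext) simp
  then show ?case by simp
next
  case (Suc k)
  then have [measurable]: "zo_iterate c h f \<mu> t U z0 k \<in> borel_measurable N" by simp
  have [measurable]: "U k i \<in> borel_measurable N" if "i \<in> {..<t}" for i
    using Suc.prems that by simp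
  have "zo_iterate c h f \<mu> t U z0 (Suc k) = (\<lambda>\<omega>. c *\<^sub>R zo_iterate c h f \<mu> t U z0 k \<omega>
      - h *\<^sub>R zo_gradient f \<mu> t (zo_iterate c h f \<mu> t U z0 k \<omega>) (\<lambda>i. U k i \<omega>))"
    by (rule ext) simp
  then show ?case by (simp add: zo_gradient_def zo_oracle_def)
qed

locale zo_descent = lipschitz_gradient f G L
  for f :: "'a::euclidean_space \<Rightarrow> real" and G :: "'a \<Rightarrow> 'a" and L :: real +
  fixes M :: "'w measure" and U :: "nat \<Rightarrow> nat \<Rightarrow> 'w \<Rightarrow> 'a"
    and c h \<mu> \<sigma> :: real and t :: nat and z0 :: 'a
  assumes c_nonneg: "0 \<le> c" and h_pos: "0 < h" and \<mu>_pos: "0 < \<mu>" and t_pos: "1 \<le> t"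
    and directions: "zo_directions M t U"
    and variance_bound: "zo_variance_bound f \<mu> \<sigma>"
begin

sublocale prob_space M
  using directions by (simp add: zo_directions_def)

lemma distr_direction: "i < t \<Longrightarrow> distr M borel (U k i) = std_gaussian"
  and indep_directions: "indep_vars (\<lambda>_. borel) (\<lambda>(k, i). U k i) (UNIV \<times> {..<t})"
  using directions by (auto simp: zo_directions_def)

lemma measurable_direction: "i < t \<Longrightarrow> U k i \<in> borel_measurable M"
  using indep_directions unfolding indep_vars_def by fastforce

abbreviation iterate :: "nat \<Rightarrow> 'w \<Rightarrow> 'a" where
  "iterate \<equiv> zo_iterate c h f \<mu> t U z0"

abbreviation mean :: "nat \<Rightarrow> 'a" where
  "mean \<equiv> zo_mean M c h f \<mu> t U z0"

definition smoothed_step :: "'a \<Rightarrow> 'a" where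
  "smoothed_step z = c *\<^sub>R z - h *\<^sub>R smoothed_gradient \<mu> z"

definition oracle_error :: "'a \<Rightarrow> 'a \<Rightarrow> 'a" where
  "oracle_error z u = zo_oracle f \<mu> z u - smoothed_gradient \<mu> z"

lemma measurable_smoothed_gradient[measurable]: "smoothed_gradient \<mu> \<in> borel_measurable borel"
  by (rule borel_measurable_continuous_onI, rule lipschitz_on_continuous_on[where L = L])
     (auto simp: lipschitz_on_def dist_norm lipschitz_smoothed_gradient[OF \<mu>_pos] L_nonneg)

lemma measurable_smoothed_step[measurable]: "smoothed_step \<in> borel_measurable borel"
  unfolding smoothed_step_def[abs_def] by measurable

lemma measurable_oracle_error[measurable (raw)]:
  assumes [measurable]: "X \<in> borel_measurable N" "Y \<in> borel_measurable N"
  shows "(\<lambda>\<omega>. oracle_error (X \<omega>) (Y \<omega>)) \<in> borel_measurable N"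
  unfolding oracle_error_def zo_oracle_def by measurable

lemma measurable_iterate[measurable]: "iterate k \<in> borel_measurable M"
  by (rule measurable_zo_iterate) (auto intro: measurable_direction)

lemma oracle_error_centred: "(LINT u|std_gaussian. oracle_error z u) = 0"
  unfolding oracle_error_def
  using integrable_zo_oracle[OF \<mu>_pos, of z] expectation_zo_oracle[OF \<mu>_pos, of z]
    std_gaussian.prob_space[where 'a = 'a]
  by simp

lemma oracle_error_variance:
  "(\<integral>\<^sup>+ u. ennreal ((norm (oracle_error z u))\<^sup>2) \<partial>std_gaussian) \<le> ennreal (\<sigma>\<^sup>2)"
  using variance_bound
  by (simp add: zo_variance_bound_def oracle_error_def
      grad_eqI[OF GDERIV_gaussian_smoothing[OF \<mu>_pos]])

text \<open>One iteration with only the first \<open>m\<close> oracle errors included. The family \<open>D\<close> of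
  directions is a parameter, because the same expression is also needed as a function on the
  product space of the directions drawn so far.\<close>

definition partial_step ::
    "(nat \<Rightarrow> nat \<Rightarrow> 'b \<Rightarrow> 'a) \<Rightarrow> nat \<Rightarrow> nat \<Rightarrow> 'b \<Rightarrow> 'a" where
  "partial_step D k m \<omega> = smoothed_step (zo_iterate c h f \<mu> t D z0 k \<omega>)
     - (h / real t) *\<^sub>R (\<Sum>i<m. oracle_error (zo_iterate c h f \<mu> t D z0 k \<omega>) (D k i \<omega>))"

lemma partial_step_full: "partial_step U k t \<omega> = iterate (Suc k) \<omega>"
proof -
  let ?z = "iterate k \<omega>"
  have "(h / real t) *\<^sub>R (\<Sum>i<t. oracle_error ?z (U k i \<omega>))
      = (h / real t) *\<^sub>R (\<Sum>i<t. zo_oracle f \<mu> ?z (U k i \<omega>)) - h *\<^sub>R smoothed_gradient \<mu> ?z"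
    using t_pos by (simp add: oracle_error_def sum_subtractf scaleR_diff_right sum_constant_scaleR)
  then show ?thesis
    by (simp add: partial_step_def smoothed_step_def zo_gradient_def)
qed

text \<open>The errors are added one at a time. When the \<open>m\<close>-th one is added, everything already
  present is a function of directions independent of the new one, so its mean square
  contributes at most \<open>(h / t)\<^sup>2 \<sigma>\<^sup>2\<close>; averaging \<open>t\<close> oracle calls divides the variance
  by \<open>t\<close>.\<close>

lemma partial_step_moments:
  assumes sq: "integrable M (\<lambda>\<omega>. (norm (smoothed_step (iterate k \<omega>) - a))\<^sup>2)" and "m \<le> t"
  shows "integrable M (\<lambda>\<omega>. (norm (partial_step U k m \<omega> - a))\<^sup>2)
    \<and> (LINT \<omega>|M. (norm (partial_step U k m \<omega> - a))\<^sup>2)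
        \<le> (LINT \<omega>|M. (norm (smoothed_step (iterate k \<omega>) - a))\<^sup>2) + real m * ((h / real t)\<^sup>2 * \<sigma>\<^sup>2)
    \<and> (LINT \<omega>|M. partial_step U k m \<omega> - a) = (LINT \<omega>|M. smoothed_step (iterate k \<omega>) - a)"
  using \<open>m \<le> t\<close>
proof (induction m)
  case 0
  then show ?case using sq by (simp add: partial_step_def)
next
  case (Suc m)
  then have m: "m < t" by simp
  define A where "A = {..<k} \<times> {..<t} \<union> {k} \<times> {..<m}"
  define N where "N = PiM A (\<lambda>_. borel :: 'a measure)"
  define K where "K = PiM {(k, m)} (\<lambda>_. borel :: 'a measure)"
  define Y where "Y \<omega> = restrict (\<lambda>i. (case i of (k, i) \<Rightarrow> U k i) \<omega>) A" for \<omega>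
  define X where "X \<omega> = restrict (\<lambda>i. (case i of (k, i) \<Rightarrow> U k i) \<omega>) {(k, m)}" for \<omega>
  define coord where "coord j i p = p (j, i)" for j i :: nat and p :: "nat \<times> nat \<Rightarrow> 'a"
  define P where "P p = partial_step coord k m p - a" for p
  define e where "e p q = - ((h / real t) *\<^sub>R
      oracle_error (zo_iterate c h f \<mu> t coord z0 k p) (q (k, m)))" for p q :: "nat \<times> nat \<Rightarrow> 'a"
  have indep: "indep_var N Y K X"
    unfolding N_def K_def Y_def[abs_def] X_def[abs_def]
    by (rule indep_var_restrict[OF indep_directions]) (use m in \<open>auto simp: A_def\<close>)
  have X[measurable]: "X \<in> measurable M K"
    using indep by (rule indep_var_rv2)
  have coord_meas: "coord j i \<in> borel_measurable N" if "(j, i) \<in> A" for j i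
    unfolding coord_def[abs_def] N_def using that by (rule measurable_component_singleton)
  have [measurable]: "zo_iterate c h f \<mu> t coord z0 k \<in> borel_measurable N"
    by (rule measurable_zo_iterate) (auto simp: A_def intro: coord_meas)
  have [measurable]: "coord k i \<in> borel_measurable N" if "i \<in> {..<m}" for i
    using that by (intro coord_meas) (simp add: A_def)
  have [measurable]: "(\<lambda>q. q (k, m)) \<in> borel_measurable K"
    unfolding K_def by (rule measurable_component_singleton) simp
  have P_meas: "P \<in> borel_measurable N"
    unfolding P_def[abs_def] partial_step_def by measurable
  have e_meas: "case_prod e \<in> borel_measurable (N \<Otimes>\<^sub>M K)"
    unfolding e_def case_prod_beta' by measurable
  have iterate_Y: "zo_iterate c h f \<mu> t coord z0 k (Y \<omega>) = iterate k \<omega>" for \<omega>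
    by (rule zo_iterate_cong) (auto simp: coord_def Y_def A_def)
  have P_Y: "P (Y \<omega>) = partial_step U k m \<omega> - a" for \<omega>
    unfolding P_def partial_step_def iterate_Y
    by (auto simp: coord_def Y_def A_def intro!: sum.cong)
  have e_YX: "e (Y \<omega>) (X \<omega>) = - ((h / real t) *\<^sub>R oracle_error (iterate k \<omega>) (U k m \<omega>))" for \<omega>
    by (simp add: e_def iterate_Y X_def)
  have step: "partial_step U k (Suc m) \<omega> - a = P (Y \<omega>) + e (Y \<omega>) (X \<omega>)" for \<omega>
    unfolding P_Y e_YX by (simp add: partial_step_def scaleR_add_right)
  have IH: "integrable M (\<lambda>\<omega>. (norm (P (Y \<omega>)))\<^sup>2)"
    using Suc by (simp add: P_Y)
  \<comment> \<open>Only one coordinate of the noise point is read, and it has the Gaussian law.\<close>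
  have X_coord: "X \<omega> (k, m) = U k m \<omega>" for \<omega>
    by (simp add: X_def)
  have [measurable]: "U k m \<in> borel_measurable M"
    using m by (rule measurable_direction)
  have var: "(\<integral>\<^sup>+ q. ennreal ((norm (e p q))\<^sup>2) \<partial>distr M K X) \<le> ennreal ((h / real t)\<^sup>2 * \<sigma>\<^sup>2)" for p
  proof -
    let ?z = "zo_iterate c h f \<mu> t coord z0 k p"
    have norm_e: "ennreal ((norm (e p q))\<^sup>2)
        = ennreal ((h / real t)\<^sup>2) * ennreal ((norm (oracle_error ?z (q (k, m))))\<^sup>2)" for q
      by (simp add: e_def power_mult_distrib power_divide flip: ennreal_mult)
    have "(\<integral>\<^sup>+ q. ennreal ((norm (e p q))\<^sup>2) \<partial>distr M K X)
        = (\<integral>\<^sup>+ \<omega>. ennreal ((h / real t)\<^sup>2) * ennreal ((norm (oracle_error ?z (U k m \<omega>)))\<^sup>2) \<partial>M)"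
      unfolding norm_e by (subst nn_integral_distr) (simp_all add: X_coord)
    also have "\<dots> = ennreal ((h / real t)\<^sup>2)
        * (\<integral>\<^sup>+ u. ennreal ((norm (oracle_error ?z u))\<^sup>2) \<partial>distr M borel (U k m))"
      by (subst nn_integral_cmult) (simp_all add: nn_integral_distr)
    also have "\<dots> \<le> ennreal ((h / real t)\<^sup>2) * ennreal (\<sigma>\<^sup>2)"
      unfolding distr_direction[OF m] by (intro mult_left_mono oracle_error_variance) simp
    finally show ?thesis by (simp add: ennreal_mult)
  qed
  have centred: "(LINT q|distr M K X. e p q) = 0" for p
  proof -
    let ?z = "zo_iterate c h f \<mu> t coord z0 k p"
    have "(LINT q|distr M K X. e p q)
        = (LINT \<omega>|M. - ((h / real t) *\<^sub>R oracle_error ?z (U k m \<omega>)))"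
      unfolding e_def by (subst integral_distr) (simp_all add: X_coord)
    also have "\<dots> = - ((h / real t) *\<^sub>R (LINT u|distr M borel (U k m). oracle_error ?z u))"
      by (subst integral_distr) simp_all
    also have "\<dots> = 0"
      unfolding distr_direction[OF m] oracle_error_centred by simp
    finally show ?thesis .
  qed
  note add = add_centred_noise[OF indep P_meas e_meas IH var centred]
  show ?case
  proof (intro conjI)
    show "integrable M (\<lambda>\<omega>. (norm (partial_step U k (Suc m) \<omega> - a))\<^sup>2)"
      unfolding step by (rule add(1)) simp
    have "(LINT \<omega>|M. (norm (partial_step U k (Suc m) \<omega> - a))\<^sup>2)
        \<le> (LINT \<omega>|M. (norm (partial_step U k m \<omega> - a))\<^sup>2) + (h / real t)\<^sup>2 * \<sigma>\<^sup>2"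
      unfolding step using add(2) by (simp add: P_Y)
    then show "(LINT \<omega>|M. (norm (partial_step U k (Suc m) \<omega> - a))\<^sup>2)
        \<le> (LINT \<omega>|M. (norm (smoothed_step (iterate k \<omega>) - a))\<^sup>2)
          + real (Suc m) * ((h / real t)\<^sup>2 * \<sigma>\<^sup>2)"
      using Suc by (simp add: algebra_simps)
    show "(LINT \<omega>|M. partial_step U k (Suc m) \<omega> - a) = (LINT \<omega>|M. smoothed_step (iterate k \<omega>) - a)"
      unfolding step using add(3) Suc by (simp add: P_Y)
  qed
qed

lemma smoothed_step_lipschitz:
  "norm (smoothed_step x - smoothed_step y) \<le> (c + h * L) * norm (x - y)"
proof -
  have "smoothed_step x - smoothed_step y
      = c *\<^sub>R (x - y) - h *\<^sub>R (smoothed_gradient \<mu> x - smoothed_gradient \<mu> y)"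
    by (simp add: smoothed_step_def algebra_simps)
  then have "norm (smoothed_step x - smoothed_step y)
      \<le> c * norm (x - y) + h * norm (smoothed_gradient \<mu> x - smoothed_gradient \<mu> y)"
    using norm_triangle_ineq4[of "c *\<^sub>R (x - y)"
        "h *\<^sub>R (smoothed_gradient \<mu> x - smoothed_gradient \<mu> y)"] c_nonneg h_pos by simp
  also have "\<dots> \<le> c * norm (x - y) + h * (L * norm (x - y))"
    using h_pos by (intro add_left_mono mult_left_mono lipschitz_smoothed_gradient \<mu>_pos) simp
  finally show ?thesis by (simp add: algebra_simps)
qed

lemma smoothed_step_square:
  assumes "integrable M (\<lambda>\<omega>. (norm (iterate k \<omega> - b))\<^sup>2)"
  shows "integrable M (\<lambda>\<omega>. (norm (smoothed_step (iterate k \<omega>) - smoothed_step b))\<^sup>2)"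
    and "(LINT \<omega>|M. (norm (smoothed_step (iterate k \<omega>) - smoothed_step b))\<^sup>2)
      \<le> (c + h * L)\<^sup>2 * (LINT \<omega>|M. (norm (iterate k \<omega> - b))\<^sup>2)"
proof -
  have le: "(norm (smoothed_step (iterate k \<omega>) - smoothed_step b))\<^sup>2
      \<le> (c + h * L)\<^sup>2 * (norm (iterate k \<omega> - b))\<^sup>2" for \<omega>
    using power_mono[OF smoothed_step_lipschitz[of "iterate k \<omega>" b], of 2]
    by (simp add: power_mult_distrib)
  show int: "integrable M (\<lambda>\<omega>. (norm (smoothed_step (iterate k \<omega>) - smoothed_step b))\<^sup>2)"
  proof (rule Bochner_Integration.integrable_bound)
    show "integrable M (\<lambda>\<omega>. (c + h * L)\<^sup>2 * (norm (iterate k \<omega> - b))\<^sup>2)"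
      using assms by simp
  qed (use le in \<open>auto intro!: AE_I2\<close>)
  have "(LINT \<omega>|M. (norm (smoothed_step (iterate k \<omega>) - smoothed_step b))\<^sup>2)
      \<le> (LINT \<omega>|M. (c + h * L)\<^sup>2 * (norm (iterate k \<omega> - b))\<^sup>2)"
    using int assms le by (intro integral_mono) auto
  then show "(LINT \<omega>|M. (norm (smoothed_step (iterate k \<omega>) - smoothed_step b))\<^sup>2)
      \<le> (c + h * L)\<^sup>2 * (LINT \<omega>|M. (norm (iterate k \<omega> - b))\<^sup>2)"
    by simp
qed

lemma iterate_square_integrable: "integrable M (\<lambda>\<omega>. (norm (iterate k \<omega> - b))\<^sup>2)"
proof (induction k arbitrary: b)
  case (Suc k)
  have "integrable M (\<lambda>\<omega>. (norm (partial_step U k t \<omega> - smoothed_step b))\<^sup>2)"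
    using partial_step_moments[OF smoothed_step_square(1)[OF Suc]] by blast
  then show ?case
    unfolding partial_step_full by (rule expectation_dist_mean_le(1)[rotated]) measurable
qed simp

lemma integrable_iterate: "integrable M (iterate k)"
  using square_integrable_norm_imp_integrable[of "iterate k"] iterate_square_integrable[of k 0]
  by simp

lemma mean_eq: "mean k = (LINT \<omega>|M. iterate k \<omega>)"
  by (simp add: zo_mean_def)

lemma mean_zero: "mean 0 = z0"
  by (simp add: zo_mean_def prob_space)

lemma integrable_smoothed_step: "integrable M (\<lambda>\<omega>. smoothed_step (iterate k \<omega>))"
proof -
  have "integrable M (\<lambda>\<omega>. smoothed_step (iterate k \<omega>) - smoothed_step 0)"
    using square_integrable_norm_imp_integrable[OF _ smoothed_step_square(1)[OF
        iterate_square_integrable[of k 0]]] by simp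
  then have "integrable M (\<lambda>\<omega>. (smoothed_step (iterate k \<omega>) - smoothed_step 0) + smoothed_step 0)"
    by (intro Bochner_Integration.integrable_add) auto
  then show ?thesis by simp
qed

text \<open>The oracle errors have mean zero even at a random iterate, as the directions are
  independent of the past.\<close>

lemma mean_Suc: "mean (Suc k) = (LINT \<omega>|M. smoothed_step (iterate k \<omega>))"
  using partial_step_moments[of k "smoothed_step 0" t]
    smoothed_step_square(1)[OF iterate_square_integrable[of k 0]]
    integrable_smoothed_step[of k] integrable_iterate[of "Suc k"]
  unfolding partial_step_full by (simp add: mean_eq prob_space del: zo_iterate.simps)

text \<open>The fluctuation about the mean is contracted with the square of the Lipschitz constant
  of a step and increased by the variance of the averaged oracle. Hence it never exceeds the
  fixed point \<open>h\<^sup>2 \<sigma>\<^sup>2 / (t (1 - (c + h L)\<^sup>2))\<close> of this recursion. The bound below is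
  larger, since \<open>1 - (c + h L)\<^sup>2\<close> exceeds \<open>(1 - c\<^sup>2 - 4 c L h - 2 L\<^sup>2 h\<^sup>2) / 2\<close> by
  \<open>(1 - c\<^sup>2) / 2\<close>.\<close>

lemma fluctuation_bound:
  assumes pos: "0 < 1 - c\<^sup>2 - 4 * c * L * h - 2 * L\<^sup>2 * h\<^sup>2" and "c < 1"
  shows "(LINT \<omega>|M. (norm (iterate k \<omega> - mean k))\<^sup>2)
    \<le> 2 * h\<^sup>2 * \<sigma>\<^sup>2 / (real t * (1 - c\<^sup>2 - 4 * c * L * h - 2 * L\<^sup>2 * h\<^sup>2))"
proof (induction k)
  case 0
  then show ?case using pos t_pos by (simp add: mean_zero)
next
  case (Suc k)
  define d where "d = 1 - c\<^sup>2 - 4 * c * L * h - 2 * L\<^sup>2 * h\<^sup>2"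
  define B where "B = 2 * h\<^sup>2 * \<sigma>\<^sup>2 / (real t * d)"
  have d: "0 < d" using pos by (simp add: d_def)
  then have B: "0 \<le> B" by (simp add: B_def)
  have "c\<^sup>2 \<le> 1" using c_nonneg \<open>c < 1\<close> by (simp add: power_le_one)
  moreover have "(c + h * L)\<^sup>2 + d / 2 = 1 - (1 - c\<^sup>2) / 2"
    by (simp add: d_def power2_eq_square field_simps)
  ultimately have rate: "(c + h * L)\<^sup>2 + d / 2 \<le> 1" by simp
  let ?a = "smoothed_step (mean k)"
  note sq = smoothed_step_square[OF iterate_square_integrable[of k "mean k"]]
  have "(LINT \<omega>|M. (norm (iterate (Suc k) \<omega> - mean (Suc k)))\<^sup>2)
      \<le> (LINT \<omega>|M. (norm (iterate (Suc k) \<omega> - ?a))\<^sup>2)"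
    unfolding mean_eq[of "Suc k"]
    by (rule expectation_dist_mean_le(2)[OF measurable_iterate iterate_square_integrable])
  also have "\<dots> \<le> (LINT \<omega>|M. (norm (smoothed_step (iterate k \<omega>) - ?a))\<^sup>2)
      + real t * ((h / real t)\<^sup>2 * \<sigma>\<^sup>2)"
    using partial_step_moments[OF sq(1), of t] unfolding partial_step_full by blast
  also have "real t * ((h / real t)\<^sup>2 * \<sigma>\<^sup>2) = d / 2 * B"
    using t_pos d by (simp add: B_def power2_eq_square field_simps)
  also have "(LINT \<omega>|M. (norm (smoothed_step (iterate k \<omega>) - ?a))\<^sup>2) \<le> (c + h * L)\<^sup>2 * B"
    using sq(2) Suc mult_left_mono[OF Suc, of "(c + h * L)\<^sup>2"] by (simp add: B_def d_def)
  finally have "(LINT \<omega>|M. (norm (iterate (Suc k) \<omega> - mean (Suc k)))\<^sup>2)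
      \<le> ((c + h * L)\<^sup>2 + d / 2) * B"
    by (simp add: distrib_right)
  also have "\<dots> \<le> B" using rate B by (rule mult_left_le_one_le[rotated 2]) (use d in simp)
  finally show ?case by (simp add: B_def d_def)
qed

text \<open>The mean follows the deterministic map up to two errors: the gradient of the smoothed
  function differs from that of \<open>f\<close>, and the mean of the gradients differs from the gradient
  at the mean by at most \<open>L\<close> times the mean fluctuation.\<close>

lemma mean_step:
  assumes "0 < 1 - c\<^sup>2 - 4 * c * L * h - 2 * L\<^sup>2 * h\<^sup>2" "c < 1"
  shows "norm (mean (Suc k) - gd_map c h f (mean k)) \<le> Q_bound DIM('a) L c h \<sigma> \<mu> t"
proof -
  let ?S = "smoothed_gradient \<mu>" and ?m = "mean k"
  let ?B = "2 * h\<^sup>2 * \<sigma>\<^sup>2 / (real t * (1 - c\<^sup>2 - 4 * c * L * h - 2 * L\<^sup>2 * h\<^sup>2))"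
  have int_d: "integrable M (\<lambda>\<omega>. iterate k \<omega> - ?m)"
    using integrable_iterate by simp
  \<comment> \<open>The smoothed gradient is recovered from the step that it defines.\<close>
  have "integrable M (\<lambda>\<omega>. (1 / h) *\<^sub>R (c *\<^sub>R iterate k \<omega> - smoothed_step (iterate k \<omega>)))"
    using integrable_iterate[of k] integrable_smoothed_step[of k]
    by (intro integrable_scaleR_right Bochner_Integration.integrable_diff) auto
  then have int_S: "integrable M (\<lambda>\<omega>. ?S (iterate k \<omega>))"
    using h_pos by (simp add: smoothed_step_def)
  have "norm ((LINT \<omega>|M. ?S (iterate k \<omega>)) - ?S ?m) = norm (LINT \<omega>|M. ?S (iterate k \<omega>) - ?S ?m)"
    using int_S by (simp add: prob_space)
  also have "\<dots> \<le> (LINT \<omega>|M. norm (?S (iterate k \<omega>) - ?S ?m))" by (rule integral_norm_bound)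
  also have "\<dots> \<le> (LINT \<omega>|M. L * norm (iterate k \<omega> - ?m))"
    using int_S int_d by (intro integral_mono lipschitz_smoothed_gradient \<mu>_pos) auto
  also have "\<dots> = L * (LINT \<omega>|M. norm (iterate k \<omega> - ?m))" by simp
  also have "\<dots> \<le> L * sqrt ?B"
    using expectation_norm_le_sqrt[OF _ iterate_square_integrable[of k ?m]]
      real_sqrt_le_mono[OF fluctuation_bound[OF assms, of k]]
    by (intro mult_left_mono L_nonneg) (auto intro: order_trans)
  finally have fluct: "norm ((LINT \<omega>|M. ?S (iterate k \<omega>)) - ?S ?m) \<le> L * sqrt ?B" .
  have "mean (Suc k) - gd_map c h f ?m
      = - (h *\<^sub>R (((LINT \<omega>|M. ?S (iterate k \<omega>)) - ?S ?m) + (?S ?m - G ?m)))"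
    using int_S integrable_iterate[of k]
    by (simp add: mean_Suc smoothed_step_def gd_map_def grad_eq mean_eq[of k] algebra_simps)
  then have "norm (mean (Suc k) - gd_map c h f ?m)
      = h * norm (((LINT \<omega>|M. ?S (iterate k \<omega>)) - ?S ?m) + (?S ?m - G ?m))"
    using h_pos by simp
  also have "\<dots> \<le> h * (L * sqrt ?B + \<mu> / 2 * L * (real DIM('a) + 3) powr (3 / 2))"
    using h_pos norm_triangle_ineq[of "(LINT \<omega>|M. ?S (iterate k \<omega>)) - ?S ?m" "?S ?m - G ?m"]
      fluct smoothing_bias[OF \<mu>_pos, of ?m]
    by (intro mult_left_mono) auto
  also have "\<dots> = Q_bound DIM('a) L c h \<sigma> \<mu> t"
    by (simp add: Q_bound_def algebra_simps)
  finally show ?thesis .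
qed

end

section \<open>Contraction of the gradient map\<close>

lemma (in lipschitz_gradient) gd_map_lipschitz:
  assumes "0 \<le> c" "0 \<le> h"
  shows "norm (gd_map c h f x - gd_map c h f y) \<le> (c + h * L) * norm (x - y)"
proof -
  have "gd_map c h f x - gd_map c h f y = c *\<^sub>R (x - y) - h *\<^sub>R (G x - G y)"
    by (simp add: gd_map_def grad_eq algebra_simps)
  then have "norm (gd_map c h f x - gd_map c h f y) \<le> c * norm (x - y) + h * norm (G x - G y)"
    using norm_triangle_ineq4[of "c *\<^sub>R (x - y)" "h *\<^sub>R (G x - G y)"] assms by simp
  also have "\<dots> \<le> c * norm (x - y) + h * (L * norm (x - y))"
    using assms by (intro add_left_mono mult_left_mono lipschitz) simp
  finally show ?thesis by (simp add: algebra_simps)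
qed

text \<open>The errors enter a geometric series; \<open>q = 0\<close> is the case of exact trajectories.\<close>

lemma perturbed_contraction:
  fixes x :: "nat \<Rightarrow> 'a::real_normed_vector"
  assumes \<rho>: "0 \<le> \<rho>" "\<rho> < 1"
    and contr: "\<And>z. norm (w z - ze) \<le> \<rho> * norm (z - ze)"
    and err: "\<And>k. norm (x (Suc k) - w (x k)) \<le> q"
  shows "norm (x k - ze) \<le> \<rho> ^ k * norm (x 0 - ze) + q / (1 - \<rho>)"
proof (induction k)
  case 0
  have "0 \<le> q" using err[of 0] norm_ge_zero order_trans by blast
  then show ?case using \<rho> by simp
next
  case (Suc k)
  have "norm (x (Suc k) - ze) \<le> norm (x (Suc k) - w (x k)) + norm (w (x k) - ze)"
    using norm_triangle_ineq[of "x (Suc k) - w (x k)" "w (x k) - ze"] by simp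
  also have "\<dots> \<le> q + \<rho> * (\<rho> ^ k * norm (x 0 - ze) + q / (1 - \<rho>))"
    using err[of k] contr[of "x k"] mult_left_mono[OF Suc \<rho>(1)] by linarith
  also have "\<dots> = \<rho> ^ Suc k * norm (x 0 - ze) + (q + \<rho> * (q / (1 - \<rho>)))"
    by (simp add: algebra_simps)
  also have "q + \<rho> * (q / (1 - \<rho>)) = q / (1 - \<rho>)"
    using \<rho> by (simp add: field_simps)
  finally show ?case .
qed

text \<open>With the distance itself as Lyapunov function, the two outer bounds are identities and
  the decrease rate is \<open>1 - \<rho>\<close> times the distance.\<close>

lemma contraction_lyapunov_function:
  fixes w :: "'a::euclidean_space \<Rightarrow> 'a"
  assumes \<rho>: "\<rho> < 1" and contr: "\<And>z. norm (w z - ze) \<le> \<rho> * norm (z - ze)"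
  shows "lyapunov_function w ze (\<lambda>z. norm (z - ze))"
proof -
  have linear: "class_K_infinity (\<lambda>s. a * s)" if "0 < a" for a
    using that unfolding class_K_infinity_def class_K_def
    by (auto intro!: continuous_intros strict_mono_onI filterlim_tendsto_pos_mult_at_top[OF tendsto_const _ filterlim_ident])
  have "local_lipschitz (UNIV :: real set) UNIV (\<lambda>_ z. norm (z - ze))"
  proof (rule local_lipschitzI)
    fix x :: 'a
    have "1-lipschitz_on (cball x 1 \<inter> UNIV) (\<lambda>z. norm (z - ze))"
      using norm_triangle_ineq3[of "a - ze" "b - ze" for a b]
      by (auto simp: lipschitz_on_def dist_norm)
    then show "\<exists>u>0. \<exists>L. \<forall>t\<in>cball t u \<inter> UNIV. L-lipschitz_on (cball x u \<inter> UNIV) (\<lambda>z. norm (z - ze))"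
      for t :: real
      by (intro exI[of _ 1]) auto
  qed
  moreover have "norm (w z - ze) - norm (z - ze) \<le> - ((1 - \<rho>) * norm (z - ze))" for z
    using contr[of z] by (simp add: algebra_simps)
  ultimately show ?thesis
    unfolding lyapunov_function_def
    using linear[of 1] linear[of "1 - \<rho>"] \<rho>
    by (intro conjI exI[of _ "\<lambda>s. 1 * s"] exI[of _ "\<lambda>s. (1 - \<rho>) * s"] exI[of _ "1::real"]) auto
qed

lemma class_K_linear: "0 < a \<Longrightarrow> class_K \<infinity> (\<lambda>s. s * a)"
  unfolding class_K_def by (auto intro!: continuous_intros strict_mono_onI)

lemma class_KL_geometric:
  assumes "0 < \<rho>" "\<rho> < 1"
  shows "class_KL (\<lambda>s t. s * \<rho> powr t)"
  unfolding class_KL_def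
proof (intro conjI allI impI)
  show "continuous_on ({0..} \<times> {0..}) (\<lambda>(s, t). s * \<rho> powr t)"
    using assms unfolding case_prod_beta' by (auto intro!: continuous_intros)
  show "class_K \<infinity> (\<lambda>s. s * \<rho> powr t)" for t
    using assms by (intro class_K_linear) simp
  fix s :: real assume s: "0 \<le> s"
  show "antimono_on {0..} (\<lambda>t. s * \<rho> powr t)"
    using assms s by (intro monotone_onI mult_left_mono powr_mono') auto
  have "((\<lambda>t. exp (ln \<rho> * t)) \<longlongrightarrow> 0) at_top"
    using assms
    by (intro filterlim_compose[OF exp_at_bot]
        filterlim_tendsto_neg_mult_at_bot[OF tendsto_const _ filterlim_ident]) simp
  then show "((\<lambda>t. s * \<rho> powr t) \<longlongrightarrow> 0) at_top"
    using assms by (intro tendsto_mult_right_zero) (simp add: powr_def mult.commute)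
qed

text \<open>The step size bound is the condition that the quadratic in \<open>h\<close> is positive, written
  with its positive root. It reads \<open>2 (c + h L)\<^sup>2 < 1 + c\<^sup>2\<close>, whose right-hand side is less
  than 2.\<close>

lemma step_size_condition:
  fixes c h L :: real
  assumes c: "0 \<le> c" "c < 1" and "0 < L" "0 < h"
    and h: "h < (sqrt (2 * (1 + c\<^sup>2)) - 2 * c) / (2 * L)"
  shows "0 < 1 - c\<^sup>2 - 4 * c * L * h - 2 * L\<^sup>2 * h\<^sup>2" and "c + h * L < 1"
proof -
  have "2 * (c + h * L) < sqrt (2 * (1 + c\<^sup>2))"
    using h \<open>0 < L\<close> by (simp add: field_simps)
  then have "(2 * (c + h * L))\<^sup>2 < (sqrt (2 * (1 + c\<^sup>2)))\<^sup>2"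
    using assms by (intro power_strict_mono) auto
  also have "(2 * (c + h * L))\<^sup>2 = 4 * (c + h * L)\<^sup>2" by (simp only: power_mult_distrib) simp
  finally have less: "4 * (c + h * L)\<^sup>2 < 2 * (1 + c\<^sup>2)" by simp
  then show "0 < 1 - c\<^sup>2 - 4 * c * L * h - 2 * L\<^sup>2 * h\<^sup>2"
    by (simp add: power2_eq_square algebra_simps)
  have "c\<^sup>2 < 1" using c by (simp add: power_less_one_iff)
  then have "(c + h * L)\<^sup>2 < 1\<^sup>2" using less by simp
  then show "c + h * L < 1" by (rule power_less_imp_less_base) simp
qed

text \<open>All four constants can be taken to be 1, because the gradient map is a contraction on
  the whole space.\<close>

theorem theorem6:
  shows "\<exists>(mubar :: real \<Rightarrow> real \<Rightarrow> real \<Rightarrow> (real ^ 'n \<Rightarrow> real) \<Rightarrow> real)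
          (qbar :: real \<Rightarrow> real \<Rightarrow> real \<Rightarrow> (real ^ 'n \<Rightarrow> real) \<Rightarrow> real)
          (rbar :: real \<Rightarrow> real \<Rightarrow> real \<Rightarrow> (real ^ 'n \<Rightarrow> real) \<Rightarrow> real)
          (tbar :: real \<Rightarrow> real \<Rightarrow> real \<Rightarrow> (real ^ 'n \<Rightarrow> real) \<Rightarrow> nat).
    \<forall>(f :: real ^ 'n \<Rightarrow> real) (L1 :: real) (c :: real) (h :: real) (ze :: real ^ 'n).
      (\<forall>x. f differentiable (at x)) \<and> continuous_on UNIV (grad f) \<and> bdd_below (range f) \<and>
      L1 > 0 \<and> (\<forall>x y. norm (grad f x - grad f y) \<le> L1 * norm (x - y)) \<and>
      0 \<le> c \<and> c < 1 \<and>
      0 < h \<and> h < (sqrt (2 * (1 + c\<^sup>2)) - 2 * c) / (2 * L1) \<and>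
      gd_converges_to c h f ze
      \<longrightarrow>
      (\<exists>V. lyapunov_function (gd_map c h f) ze V) \<and>
      (\<forall>V. lyapunov_function (gd_map c h f) ze V \<longrightarrow>
        mubar h c L1 V > 0 \<and> qbar h c L1 V > 0 \<and> rbar h c L1 V > 0 \<and>
        (\<exists>\<kappa> \<alpha> (a :: ereal).
          class_KL \<kappa> \<and> class_K a \<alpha> \<and> ereal (qbar h c L1 V) < a \<and>
          (\<forall>z. gd_trajectory c h f z \<and> z 0 \<in> cball ze (rbar h c L1 V) \<longrightarrow>
            (\<forall>k. norm (z k - ze) \<le> \<kappa> (norm (z 0 - ze)) (real k))) \<and>
          (\<forall>(\<sigma> :: real) (\<mu> :: real) (t :: nat)
             (M :: 'w measure) (U :: nat \<Rightarrow> nat \<Rightarrow> 'w \<Rightarrow> real ^ 'n) (z0 :: real ^ 'n).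
            0 \<le> \<sigma> \<and> 0 < \<mu> \<and> \<mu> < mubar h c L1 V \<and> 1 \<le> t \<and> tbar h c L1 V \<le> t \<and>
            Q_bound CARD('n) L1 c h \<sigma> \<mu> t \<le> qbar h c L1 V \<and>
            zo_variance_bound f \<mu> \<sigma> \<and>
            zo_directions M t U \<and>
            z0 \<in> cball ze (rbar h c L1 V)
            \<longrightarrow>
            (\<forall>k. norm (zo_mean M c h f \<mu> t U z0 k - ze)
                  \<le> \<kappa> (norm (zo_mean M c h f \<mu> t U z0 0 - ze)) (real k)
                    + \<alpha> (Q_bound CARD('n) L1 c h \<sigma> \<mu> t)))))"
proof (intro exI[of _ "\<lambda>_ _ _ _. 1"] allI impI, elim conjE)
  fix f :: "real ^ 'n \<Rightarrow> real" and L1 c h :: real and ze :: "real ^ 'n"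
  assume diff: "\<forall>x. f differentiable at x"
    and L1: "0 < L1" and lip: "\<forall>x y. norm (grad f x - grad f y) \<le> L1 * norm (x - y)"
    and c: "0 \<le> c" "c < 1" and h: "0 < h" "h < (sqrt (2 * (1 + c\<^sup>2)) - 2 * c) / (2 * L1)"
    and conv: "gd_converges_to c h f ze"
  define \<rho> where "\<rho> = c + h * L1"
  note step_size = step_size_condition[OF c L1 h]
  have \<rho>: "0 < \<rho>" "\<rho> < 1"
    using step_size c L1 h by (auto simp: \<rho>_def intro: add_nonneg_pos)
  interpret lipschitz_gradient f "grad f" L1
    using diff lip L1 by unfold_locales (auto intro: GDERIV_grad)
  have fixpoint: "gd_map c h f ze = ze"
    using conv by (simp add: gd_converges_to_def)
  have contr: "norm (gd_map c h f z - ze) \<le> \<rho> * norm (z - ze)" for z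
    using gd_map_lipschitz[of c h z ze] c h by (simp add: fixpoint \<rho>_def)
  let ?\<kappa> = "\<lambda>s t. s * \<rho> powr t" and ?\<alpha> = "\<lambda>s. s * (1 / (1 - \<rho>))"
  have lyapunov: "\<exists>V. lyapunov_function (gd_map c h f) ze V"
    using contraction_lyapunov_function[OF \<rho>(2) contr] by blast
  have gd: "norm (z k - ze) \<le> ?\<kappa> (norm (z 0 - ze)) (real k)"
    if "gd_trajectory c h f z" for z k
    using perturbed_contraction[OF _ \<rho>(2) contr, of z 0 k] \<rho> that
    by (simp add: gd_trajectory_def powr_realpow mult.commute)
  have zo: "norm (zo_mean M c h f \<mu> t U z0 k - ze)
      \<le> ?\<kappa> (norm (zo_mean M c h f \<mu> t U z0 0 - ze)) (real k)
        + ?\<alpha> (Q_bound CARD('n) L1 c h \<sigma> \<mu> t)"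
    if "0 < \<mu>" "1 \<le> t" "zo_variance_bound f \<mu> \<sigma>" "zo_directions M t U"
    for \<sigma> \<mu> t and M :: "'w measure" and U and z0 :: "real ^ 'n" and k
  proof -
    interpret zo_descent f "grad f" L1 M U c h \<mu> \<sigma> t z0
      using that c h by unfold_locales auto
    show ?thesis
      using perturbed_contraction[OF _ \<rho>(2) contr, of mean "Q_bound CARD('n) L1 c h \<sigma> \<mu> t" k]
        mean_step[OF step_size(1) c(2)] \<rho>
      by (simp add: powr_realpow mult.commute)
  qed
  show "(\<exists>V. lyapunov_function (gd_map c h f) ze V) \<and>
      (\<forall>V. lyapunov_function (gd_map c h f) ze V \<longrightarrow>
        (1::real) > 0 \<and> (1::real) > 0 \<and> (1::real) > 0 \<and>
        (\<exists>\<kappa> \<alpha> (a :: ereal).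
          class_KL \<kappa> \<and> class_K a \<alpha> \<and> ereal 1 < a \<and>
          (\<forall>z. gd_trajectory c h f z \<and> z 0 \<in> cball ze 1 \<longrightarrow>
            (\<forall>k. norm (z k - ze) \<le> \<kappa> (norm (z 0 - ze)) (real k))) \<and>
          (\<forall>(\<sigma> :: real) (\<mu> :: real) (t :: nat)
             (M :: 'w measure) (U :: nat \<Rightarrow> nat \<Rightarrow> 'w \<Rightarrow> real ^ 'n) (z0 :: real ^ 'n).
            0 \<le> \<sigma> \<and> 0 < \<mu> \<and> \<mu> < 1 \<and> 1 \<le> t \<and> 1 \<le> t \<and>
            Q_bound CARD('n) L1 c h \<sigma> \<mu> t \<le> 1 \<and>
            zo_variance_bound f \<mu> \<sigma> \<and>
            zo_directions M t U \<and>
            z0 \<in> cball ze 1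
            \<longrightarrow>
            (\<forall>k. norm (zo_mean M c h f \<mu> t U z0 k - ze)
                  \<le> \<kappa> (norm (zo_mean M c h f \<mu> t U z0 0 - ze)) (real k)
                    + \<alpha> (Q_bound CARD('n) L1 c h \<sigma> \<mu> t)))))"
    using lyapunov gd zo class_KL_geometric[OF \<rho>] class_K_linear[of "1 / (1 - \<rho>)"] \<rho>(2)
    by (intro conjI allI impI exI[of _ ?\<kappa>] exI[of _ ?\<alpha>] exI[of _ "\<infinity>::ereal"]) auto
qed

end
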